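(* Let $\mathcal{A}$ be a free line arrangement in the complex projective plane $\mathbb{P}^2$, consisting of $d=|\mathcal{A}|$ lines and such that $\mathcal{A}$ is not a pencil. Let $m$ be the maximal multiplicity of an intersection point in $\mathcal{A}$, and let $n_2$ be the number of double points of $\mathcal{A}$. If $2m\ge d$, then $$n_2\ \ge\ -2m^2+(3d-1)m-d^2+d\ \ge\ \frac{d}{2}.$$ In particular, if $\mathcal{A}$ is an $m$-homogeneous supersolvable line arrangement, not a pencil, consisting of $d=|\mathcal{A}|$ lines such that $2m\ge d$, then $n_2\ge \frac{d}{2}$.
   Context: A line arrangement in $\mathbb{P}^2$ is a finite set of distinct lines; it is a pencil if all its lines pass through one common point. An intersection point is a point lying on at least two lines of the arrangement; its multiplicity is the number of lines through it, and a double point is an intersection point of multiplicity exactly $2$. Let $S=\mathbb{C}[x,y,z]$ and $\mathrm{Der}\,S=S\partial_x\oplus S\partial_y\oplus S\partial_z$, and for each line $H\in\mathcal{A}$ let $\alpha_H$ be a linear form defining $H$. The arrangement $\mathcal{A}$ is free if the graded $S$-module $D(\mathcal{A})=\{\theta\in\mathrm{Der}\,S : \theta(\alpha_H)\in S\alpha_H \text{ for all } H\in\mathcal{A}\}$ is free. An intersection point $p$ is modular if for every other intersection point $q$ the line $\overline{pq}$ belongs to the arrangement. The arrangement is supersolvable if it has a modular point, and it is $m$-homogeneous supersolvable if it is supersolvable and all its modular points have the same multiplicity $m$. *)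

theory Defs
  imports
    "HOL-Analysis.Analysis"
    "HOL-Computational_Algebra.Polynomial"
begin

text \<open>
  The complex projective plane is the space of linear subspaces of \<open>\<complex>\<^sup>3\<close>: its points are the
  1-dimensional subspaces, its lines the 2-dimensional ones, and incidence is inclusion.
\<close>

definition proj_point :: "(complex^3) set \<Rightarrow> bool" where
  "proj_point p \<longleftrightarrow> vec.subspace p \<and> vec.dim p = 1"

definition proj_line :: "(complex^3) set \<Rightarrow> bool" where
  "proj_line H \<longleftrightarrow> vec.subspace H \<and> vec.dim H = 2"

definition line_arrangement :: "(complex^3) set set \<Rightarrow> bool" where
  "line_arrangement A \<longleftrightarrow> finite A \<and> (\<forall>H\<in>A. proj_line H)"

definition pencil :: "(complex^3) set set \<Rightarrow> bool" where
  "pencil A \<longleftrightarrow> (\<exists>p. proj_point p \<and> (\<forall>H\<in>A. p \<subseteq> H))"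

definition point_mult :: "(complex^3) set set \<Rightarrow> (complex^3) set \<Rightarrow> nat" where
  "point_mult A p = card {H \<in> A. p \<subseteq> H}"

definition intersection_points :: "(complex^3) set set \<Rightarrow> (complex^3) set set" where
  "intersection_points A = {p. proj_point p \<and> point_mult A p \<ge> 2}"

definition max_mult :: "(complex^3) set set \<Rightarrow> nat" where
  "max_mult A = Max (point_mult A ` intersection_points A)"

definition double_points :: "(complex^3) set set \<Rightarrow> (complex^3) set set" where
  "double_points A = {p \<in> intersection_points A. point_mult A p = 2}"

text \<open>For distinct points \<open>p\<close> and \<open>q\<close>, the line joining them is the subspace spanned by both.\<close>

definition modular_point :: "(complex^3) set set \<Rightarrow> (complex^3) set \<Rightarrow> bool" where
  "modular_point A p \<longleftrightarrow> p \<in> intersection_points A \<and>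
     (\<forall>q \<in> intersection_points A. q \<noteq> p \<longrightarrow> vec.span (p \<union> q) \<in> A)"

definition supersolvable :: "(complex^3) set set \<Rightarrow> bool" where
  "supersolvable A \<longleftrightarrow> (\<exists>p. modular_point A p)"

definition homogeneous_supersolvable :: "nat \<Rightarrow> (complex^3) set set \<Rightarrow> bool" where
  "homogeneous_supersolvable m A \<longleftrightarrow>
     supersolvable A \<and> (\<forall>p. modular_point A p \<longrightarrow> point_mult A p = m)"

text \<open>
  \<open>S = \<complex>[x,y,z]\<close> is the iterated polynomial ring \<open>\<complex>[x][y][z]\<close>, so \<open>z\<close> is the outermost variable.
\<close>

type_synonym S = "complex poly poly poly"

definition const :: "complex \<Rightarrow> S" where "const c = [:[:[:c:]:]:]"
definition varx :: S where "varx = [:[:[:0, 1:]:]:]"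
definition vary :: S where "vary = [:[:0, 1:]:]"
definition varz :: S where "varz = [:0, 1:]"

definition dx :: "S \<Rightarrow> S" where "dx f = map_poly (map_poly pderiv) f"
definition dy :: "S \<Rightarrow> S" where "dy f = map_poly pderiv f"
definition dz :: "S \<Rightarrow> S" where "dz f = pderiv f"

text \<open>
  An element \<open>\<theta>\<close> of \<open>S^3\<close> stands for the derivation
  \<open>\<theta>$1 \<partial>\<^sub>x + \<theta>$2 \<partial>\<^sub>y + \<theta>$3 \<partial>\<^sub>z\<close> in \<open>Der S = S \<partial>\<^sub>x \<oplus> S \<partial>\<^sub>y \<oplus> S \<partial>\<^sub>z\<close>.
\<close>

definition der_apply :: "S^3 \<Rightarrow> S \<Rightarrow> S" where
  "der_apply \<theta> f = \<theta>$1 * dx f + \<theta>$2 * dy f + \<theta>$3 * dz f"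

definition linear_form :: "complex^3 \<Rightarrow> S" where
  "linear_form a = const (a$1) * varx + const (a$2) * vary + const (a$3) * varz"

definition defining_form :: "(complex^3) set \<Rightarrow> S \<Rightarrow> bool" where
  "defining_form H \<alpha> \<longleftrightarrow>
     (\<exists>a. \<alpha> = linear_form a \<and> H = {v. a$1 * v$1 + a$2 * v$2 + a$3 * v$3 = 0})"

text \<open>
  The linear form defining a line is unique up to a nonzero scalar, which does not affect the
  condition; hence the quantification over all of them amounts to any choice of one per line.
\<close>

definition derivation_module :: "(complex^3) set set \<Rightarrow> (S^3) set" where
  "derivation_module A =
     {\<theta>. \<forall>H\<in>A. \<forall>\<alpha>. defining_form H \<alpha> \<longrightarrow> \<alpha> dvd der_apply \<theta> \<alpha>}"

interpretation DerS: module "(*s) :: S \<Rightarrow> S^3 \<Rightarrow> S^3"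
  by unfold_locales (simp_all add: vec_eq_iff algebra_simps)

lemma subspace_derivation_module: "DerS.subspace (derivation_module A)"
  unfolding DerS.subspace_def derivation_module_def der_apply_def
proof (safe, goal_cases)
  case (2 \<theta> \<eta> H \<alpha>)
  have "\<alpha> dvd (\<theta>$1 * dx \<alpha> + \<theta>$2 * dy \<alpha> + \<theta>$3 * dz \<alpha>) + (\<eta>$1 * dx \<alpha> + \<eta>$2 * dy \<alpha> + \<eta>$3 * dz \<alpha>)"
    by (rule dvd_add) (use 2 in blast)+
  then show ?case by (simp add: algebra_simps)
next
  case (3 c \<theta> H \<alpha>)
  have "\<alpha> dvd c * (\<theta>$1 * dx \<alpha> + \<theta>$2 * dy \<alpha> + \<theta>$3 * dz \<alpha>)"
    by (rule dvd_mult) (use 3 in blast)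
  then show ?case by (simp add: algebra_simps)
qed simp

definition free_arrangement :: "(complex^3) set set \<Rightarrow> bool" where
  "free_arrangement A \<longleftrightarrow>
     (\<exists>B. DerS.independent B \<and> DerS.span B = derivation_module A)"

end

theory Submission
  imports Defs
    "HOL-Computational_Algebra.Polynomial_Factorial"
    "HOL-Computational_Algebra.Field_as_Ring"
begin

text \<open>
  Let \<open>p\<close> be a point of multiplicity \<open>m\<close> with \<open>2m \<ge> d\<close>. If \<open>p\<close> is modular, every line \<open>L\<close> off \<open>p\<close>
  carries exactly \<open>m\<close> intersection points; as these absorb the \<open>d - 1\<close> other lines, at least
  \<open>2m - d + 1\<close> of them are double, and no double point is shared by two such lines. This gives
  \<open>n\<^sub>2 \<ge> (d - m)(2m - d + 1)\<close>, which is the claimed bound.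

  So it suffices that freeness makes \<open>p\<close> modular. By Saito's criterion \<open>D(A)\<close> contains homogeneous
  fields \<open>\<theta>\<^sub>1, \<theta>\<^sub>2\<close> of degrees \<open>d\<^sub>1 \<le> d\<^sub>2\<close>, \<open>d\<^sub>1 + d\<^sub>2 = d - 1\<close>, with \<open>det(E, \<theta>\<^sub>1, \<theta>\<^sub>2) \<noteq> 0\<close> for
  the Euler field \<open>E\<close>. If \<open>p\<close> is not modular, some line \<open>L\<close> off \<open>p\<close> carries more than \<open>m\<close>
  intersection points. If \<open>L\<close> carries more than \<open>e + 1\<close> of them, then every \<open>\<theta> \<in> D(A)\<close> of degree \<open>e\<close>
  is a multiple of \<open>E\<close> along \<open>L\<close>, since \<open>\<theta> \<and> E\<close> has degree \<open>e + 1\<close> and vanishes at these points.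
  For two fields \<open>\<theta>, \<eta> \<in> D(A)\<close> that are multiples of \<open>E\<close> along \<open>L\<close>, \<open>det(E, \<theta>, \<eta>)\<close> is divisible by
  the defining polynomial of \<open>A\<close> times the form of \<open>L\<close>, so it vanishes unless the degrees of \<open>\<theta>\<close>
  and \<open>\<eta>\<close> add up to at least \<open>d\<close>. Hence \<open>d\<^sub>2 \<ge> m\<close> and \<open>d\<^sub>1 < d - m\<close>.

  The field \<open>\<theta>\<^sub>p = Q' w\<close>, where \<open>w\<close> spans \<open>p\<close> and \<open>Q'\<close> is the product of the forms of the \<open>d - m\<close>
  lines off \<open>p\<close>, vanishes on \<open>L\<close>. As \<open>d\<^sub>1 + (d - m) < d\<close>, it follows that \<open>det(E, \<theta>\<^sub>1, \<theta>\<^sub>p) = 0\<close>,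
  whence \<open>\<theta>\<^sub>1 = h E + g w\<close> for polynomials \<open>g, h\<close>. Tangency makes \<open>Q'\<close> divide \<open>g\<close>, contradicting
  \<open>d\<^sub>1 < d - m\<close>.
\<close>

section \<open>Polynomial functions on \<open>\<complex>\<^sup>3\<close>\<close>

definition ev :: "S \<Rightarrow> complex^3 \<Rightarrow> complex" where
  "ev f v = poly (poly (poly f [:[:v$3:]:]) [:v$2:]) (v$1)"

lemma ev_simps [simp]:
  "ev 0 v = 0" "ev 1 v = 1" "ev (f + g) v = ev f v + ev g v" "ev (f - g) v = ev f v - ev g v"
  "ev (- f) v = - ev f v" "ev (f * g) v = ev f v * ev g v" "ev (const c) v = c"
  "ev varx v = v$1" "ev vary v = v$2" "ev varz v = v$3"
  by (simp_all add: ev_def const_def varx_def vary_def varz_def)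

lemma ev_sum [simp]: "ev (sum f I) v = (\<Sum>i\<in>I. ev (f i) v)"
  by (induction I rule: infinite_finite_induct) auto

lemma ev_prod [simp]: "ev (prod f I) v = (\<Prod>i\<in>I. ev (f i) v)"
  by (induction I rule: infinite_finite_induct) auto

lemma poly_eq_0_if_inj_roots:
  fixes f :: "'a::idom poly" and r :: "'b \<Rightarrow> 'a"
  assumes "infinite (UNIV :: 'b set)" "inj r" "\<And>c. poly f (r c) = 0"
  shows "f = 0"
proof (rule ccontr)
  assume "f \<noteq> 0"
  then have "finite {x. poly f x = 0}" by (rule poly_roots_finite)
  then have "finite (range r)" by (rule rev_finite_subset) (use assms(3) in auto)
  then show False using assms(1,2) by (simp add: finite_image_iff)
qed

lemma poly_poly_eqI:
  fixes f g :: "'a::{idom,ring_char_0} poly poly"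
  assumes "\<And>x y. poly (poly f [:y:]) x = poly (poly g [:y:]) x"
  shows "f = g"
proof -
  have "poly (f - g) [:y:] = 0" for y
    using assms by (simp add: poly_all_0_iff_0 [symmetric])
  then have "f - g = 0"
    by (intro poly_eq_0_if_inj_roots[where r = "\<lambda>y. [:y:]"])
      (auto simp: inj_def infinite_UNIV_char_0)
  then show ?thesis by simp
qed

lemma S_eqI:
  assumes "\<And>v. ev f v = ev g v"
  shows "f = g"
proof -
  have "poly (f - g) [:[:z:]:] = 0" for z
  proof -
    have "poly (poly (poly f [:[:z:]:]) [:y:]) x = poly (poly (poly g [:[:z:]:]) [:y:]) x" for x y
      using assms[of "vector [x, y, z]"] by (simp add: ev_def)
    then have "poly f [:[:z:]:] = poly g [:[:z:]:]" by (rule poly_poly_eqI)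
    then show ?thesis by simp
  qed
  then have "f - g = 0"
    by (intro poly_eq_0_if_inj_roots[where r = "\<lambda>z. [:[:z:]:]"])
      (auto simp: inj_def infinite_UNIV_char_0)
  then show ?thesis by simp
qed

definition dot3 :: "'a::comm_ring_1^3 \<Rightarrow> 'a^3 \<Rightarrow> 'a" where
  "dot3 a v = a$1 * v$1 + a$2 * v$2 + a$3 * v$3"

lemma dot3_linear [simp]:
  "dot3 a (v + w) = dot3 a v + dot3 a w" "dot3 a (v - w) = dot3 a v - dot3 a w"
  "dot3 a (c *s v) = c * dot3 a v" "dot3 (a - b) v = dot3 a v - dot3 b v"
  "dot3 (c *s a) v = c * dot3 a v" "dot3 0 v = 0" "dot3 a 0 = 0"
  by (simp_all add: dot3_def algebra_simps)

lemma dot3_axis [simp]: "dot3 a (axis i c) = a$i * c"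
  using exhaust_3[of i] by (auto simp: dot3_def axis_def)

lemma dot3_sum: "dot3 a (sum f I) = (\<Sum>i\<in>I. dot3 a (f i))"
  by (induction I rule: infinite_finite_induct) auto

lemma subspace_dot3_kernel: "vec.subspace {v. dot3 a v = 0}" for a :: "'a::field^3"
  by (simp add: vec.subspace_def)

lemma ev_linear_form [simp]: "ev (linear_form a) v = dot3 a v"
  by (simp add: linear_form_def dot3_def)

lemma S_induct [case_names const add linear_mult]:
  assumes const: "\<And>c. P (const c)"
    and add: "\<And>f g. P f \<Longrightarrow> P g \<Longrightarrow> P (f + g)"
    and linear_mult: "\<And>a f. P f \<Longrightarrow> P (linear_form a * f)"
  shows "P f"
proof -
  have zero: "P 0" using const[of 0] by (simp add: const_def)
  have forms: "linear_form (axis 1 1) = varx" "linear_form (axis 2 1) = vary"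
    "linear_form (axis 3 1) = varz"
    by (rule S_eqI, simp add: dot3_def axis_def)+
  have x: "P [:[:h:]:]" for h
  proof (induction h)
    case (pCons a h)
    have "[:[:pCons a h:]:] = const a + linear_form (axis 1 1) * [:[:h:]:]"
      by (simp add: forms const_def varx_def)
    then show ?case using const add linear_mult pCons.IH by metis
  qed (simp add: zero)
  have xy: "P [:g:]" for g
  proof (induction g)
    case (pCons h g)
    have "[:pCons h g:] = [:[:h:]:] + linear_form (axis 2 1) * [:g:]"
      by (simp add: forms vary_def)
    then show ?case using x add linear_mult pCons.IH by metis
  qed (simp add: zero)
  show ?thesis
  proof (induction f)
    case (pCons g f)
    have "pCons g f = [:g:] + linear_form (axis 3 1) * f"
      by (simp add: forms varz_def)
    then show ?case using xy add linear_mult pCons.IH by metis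
  qed (rule zero)
qed

lemma ev_on_affine_line: "\<exists>p. \<forall>t. ev f (v + t *s w) = poly p t"
proof (induction f rule: S_induct)
  case (const c)
  then show ?case by (intro exI[of _ "[:c:]"]) simp
next
  case (add f g)
  then obtain p q where "\<forall>t. ev f (v + t *s w) = poly p t" "\<forall>t. ev g (v + t *s w) = poly q t"
    by auto
  then show ?case by (intro exI[of _ "p + q"]) simp
next
  case (linear_mult a f)
  then obtain p where "\<forall>t. ev f (v + t *s w) = poly p t" by auto
  then show ?case by (intro exI[of _ "[:dot3 a v, dot3 a w:] * p"]) (simp add: algebra_simps)
qed

lemma vanish_on_subspace_prime:
  assumes H: "vec.subspace H" and fg: "\<And>v. v \<in> H \<Longrightarrow> ev (f * g) v = 0"
  shows "(\<forall>v\<in>H. ev f v = 0) \<or> (\<forall>v\<in>H. ev g v = 0)"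
proof (rule ccontr)
  assume "\<not> ?thesis"
  then obtain v w where vw: "v \<in> H" "w \<in> H" "ev f v \<noteq> 0" "ev g w \<noteq> 0" by auto
  obtain p where p: "\<And>t. ev f (v + t *s (w - v)) = poly p t"
    using ev_on_affine_line by blast
  obtain q where q: "\<And>t. ev g (v + t *s (w - v)) = poly q t"
    using ev_on_affine_line by blast
  have "poly (p * q) t = 0" for t
  proof -
    have "v + t *s (w - v) \<in> H"
      using H vw by (intro vec.subspace_add vec.subspace_scale vec.subspace_diff)
    then show ?thesis using fg[of "v + t *s (w - v)"] by (simp only: ev_simps p q poly_mult)
  qed
  then have "p * q = 0" using poly_all_0_iff_0 by blast
  then show False using p[of 0] q[of 1] vw by auto
qed

lemma linear_form_remainder:
  assumes u: "dot3 a u = 1"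
  shows "\<exists>h. linear_form a dvd f - h \<and> (\<forall>v. ev h v = ev f (v - dot3 a v *s u))"
proof (induction f rule: S_induct)
  case (const c)
  then show ?case by (intro exI[of _ "const c"]) simp
next
  case (add f g)
  then obtain h k where dvd: "linear_form a dvd f - h" "linear_form a dvd g - k"
    and ev: "\<forall>v. ev h v = ev f (v - dot3 a v *s u)" "\<forall>v. ev k v = ev g (v - dot3 a v *s u)"
    by auto
  have "linear_form a dvd (f + g) - (h + k)"
    using dvd_add[OF dvd] by (simp add: algebra_simps)
  then show ?case using ev by (intro exI[of _ "h + k"]) simp
next
  case (linear_mult b f)
  then obtain h where dvd: "linear_form a dvd f - h"
    and ev: "\<forall>v. ev h v = ev f (v - dot3 a v *s u)" by auto
  define c where "c = dot3 b u"
  define l where "l = linear_form (b - c *s a)"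
  have "linear_form b = linear_form a * const c + l"
    by (rule S_eqI) (simp add: l_def algebra_simps)
  then have "linear_form b * f - l * h = linear_form a * (const c * f) + l * (f - h)"
    by (simp add: algebra_simps)
  then have "linear_form a dvd linear_form b * f - l * h" using dvd by simp
  moreover have "ev (l * h) v = ev (linear_form b * f) (v - dot3 a v *s u)" for v
    using ev by (simp add: l_def c_def mult.commute)
  ultimately show ?case by (intro exI[of _ "l * h"] conjI allI)
qed

lemma linear_form_dvd_iff:
  assumes "a \<noteq> 0"
  shows "linear_form a dvd f \<longleftrightarrow> (\<forall>v. dot3 a v = 0 \<longrightarrow> ev f v = 0)"
proof
  assume "linear_form a dvd f"
  then show "\<forall>v. dot3 a v = 0 \<longrightarrow> ev f v = 0" by (auto elim!: dvdE)
next
  assume vanish: "\<forall>v. dot3 a v = 0 \<longrightarrow> ev f v = 0"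
  obtain i where "a$i \<noteq> 0" using assms by (auto simp: vec_eq_iff)
  then have u: "dot3 a (axis i (1 / a$i)) = 1" by simp
  obtain h where h: "linear_form a dvd f - h"
    and ev_h: "\<And>v. ev h v = ev f (v - dot3 a v *s axis i (1 / a$i))"
    using linear_form_remainder[OF u] by metis
  have "h = 0" by (rule S_eqI) (use vanish u in \<open>simp add: ev_h\<close>)
  then show "linear_form a dvd f" using h by simp
qed

lemma linear_form_eq_0_iff [simp]: "linear_form a = 0 \<longleftrightarrow> a = 0"
proof
  assume "linear_form a = 0"
  then have "dot3 a (axis i 1) = 0" for i by (metis ev_linear_form ev_simps(1))
  then show "a = 0" by (simp add: vec_eq_iff)
qed (rule S_eqI, simp)

lemma prime_linear_form:
  assumes "a \<noteq> 0"
  shows "prime_elem (linear_form a)"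
proof (rule prime_elemI)
  show "linear_form a \<noteq> 0" using assms by simp
  show "\<not> linear_form a dvd 1" by (auto simp: linear_form_dvd_iff[OF assms] intro: exI[of _ 0])
  show "linear_form a dvd f \<or> linear_form a dvd g" if "linear_form a dvd f * g" for f g
    using that vanish_on_subspace_prime[OF subspace_dot3_kernel, of a f g]
    by (simp add: linear_form_dvd_iff[OF assms])
qed

lemma const_eq_0_iff [simp]: "const c = 0 \<longleftrightarrow> c = 0"
  by (simp add: const_def)

lemma is_unit_S_iff: "f dvd 1 \<longleftrightarrow> (\<exists>c. c \<noteq> 0 \<and> f = const c)" for f :: S
  by (auto simp: is_unit_poly_iff const_def dvd_field_iff)

section \<open>Homogeneous polynomials\<close>

definition homogeneous :: "nat \<Rightarrow> S \<Rightarrow> bool" where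
  "homogeneous n f \<longleftrightarrow> (\<forall>t v. ev f (t *s v) = t ^ n * ev f v)"

lemma homogeneous_ev: "homogeneous n f \<Longrightarrow> ev f (t *s v) = t ^ n * ev f v"
  by (simp add: homogeneous_def)

lemma homogeneous_0 [simp]: "homogeneous n 0"
  and homogeneous_const: "homogeneous 0 (const c)"
  and homogeneous_linear_form: "homogeneous 1 (linear_form a)"
  and homogeneous_add: "homogeneous n f \<Longrightarrow> homogeneous n g \<Longrightarrow> homogeneous n (f + g)"
  and homogeneous_diff: "homogeneous n f \<Longrightarrow> homogeneous n g \<Longrightarrow> homogeneous n (f - g)"
  and homogeneous_mult: "homogeneous n f \<Longrightarrow> homogeneous k g \<Longrightarrow> homogeneous (n + k) (f * g)"
  by (simp_all add: homogeneous_def algebra_simps power_add)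

lemma homogeneous_sum: "(\<And>i. i \<in> I \<Longrightarrow> homogeneous n (h i)) \<Longrightarrow> homogeneous n (sum h I)"
  by (induction I rule: infinite_finite_induct) (auto intro: homogeneous_add)

lemma homogeneous_prod:
  "(\<And>i. i \<in> I \<Longrightarrow> homogeneous (e i) (h i)) \<Longrightarrow> homogeneous (sum e I) (prod h I)"
  by (simp add: homogeneous_def prod.distrib power_sum)

lemma homogeneous_sum_component:
  assumes I: "finite I" and h: "\<And>i. i \<in> I \<Longrightarrow> homogeneous (e i) (h i)"
    and sum: "homogeneous n (sum h I)"
  shows "sum h I = (\<Sum>i\<in>{i\<in>I. e i = n}. h i)"
proof (rule S_eqI)
  fix v
  have "poly (\<Sum>i\<in>I. monom (ev (h i) v) (e i)) t = poly (monom (ev (sum h I) v) n) t" for t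
    using homogeneous_ev[OF sum, of t v]
    by (simp add: poly_sum poly_monom homogeneous_ev[OF h] mult.commute cong: sum.cong)
  then have "(\<Sum>i\<in>I. monom (ev (h i) v) (e i)) = monom (ev (sum h I) v) n"
    by (simp add: poly_eq_poly_eq_iff[symmetric] fun_eq_iff)
  then have "coeff (\<Sum>i\<in>I. monom (ev (h i) v) (e i)) n = coeff (monom (ev (sum h I) v) n) n"
    by simp
  then show "ev (sum h I) v = ev (\<Sum>i\<in>{i\<in>I. e i = n}. h i) v"
    using I by (simp add: coeff_sum sum.inter_filter[of I "\<lambda>i. ev (h i) v"])
qed

text \<open>The polynomial \<open>P\<close> is \<open>f(tx, ty, tz)\<close> as a polynomial in \<open>t\<close>.\<close>

lemma homogeneous_coeffs:
  "\<exists>P :: S poly. (\<forall>k. homogeneous k (coeff P k)) \<and> poly P 1 = f"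
proof (induction f rule: S_induct)
  case (const c)
  have "homogeneous k (coeff [:const c:] k)" for k
    by (cases k) (auto intro: homogeneous_const)
  then show ?case by (intro exI[of _ "[:const c:]"]) simp
next
  case (add f g)
  then obtain P Q :: "S poly" where "\<forall>k. homogeneous k (coeff P k)" "\<forall>k. homogeneous k (coeff Q k)"
    "poly P 1 = f" "poly Q 1 = g" by auto
  then show ?case by (intro exI[of _ "P + Q"]) (auto intro: homogeneous_add)
next
  case (linear_mult a f)
  then obtain P :: "S poly" where P: "\<And>k. homogeneous k (coeff P k)" "poly P 1 = f" by auto
  have "homogeneous k (coeff (pCons 0 (smult (linear_form a) P)) k)" for k
    using homogeneous_mult[OF homogeneous_linear_form P(1)] by (cases k) auto
  then show ?case using P(2) by (intro exI[of _ "pCons 0 (smult (linear_form a) P)"]) simp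
qed

lemma homogeneous_factor:
  assumes f: "homogeneous k f" and fg: "homogeneous n (f * g)" "f * g \<noteq> 0"
  shows "k \<le> n" "homogeneous (n - k) g"
proof -
  obtain P :: "S poly" where P: "\<And>j. homogeneous j (coeff P j)" "poly P 1 = g"
    using homogeneous_coeffs by blast
  have g: "g = (\<Sum>j\<le>degree P. coeff P j)" using P(2) by (simp add: poly_altdef)
  define J where "J = {j \<in> {..degree P}. k + j = n}"
  have "f * g = (\<Sum>j\<le>degree P. f * coeff P j)" by (simp add: g sum_distrib_left)
  also have "\<dots> = (\<Sum>j\<in>J. f * coeff P j)"
    unfolding J_def
    by (rule homogeneous_sum_component)
      (use fg(1) in \<open>auto intro: homogeneous_mult f P(1) simp: g sum_distrib_left\<close>)
  finally have "f * g = f * (\<Sum>j\<in>J. coeff P j)" by (simp add: sum_distrib_left)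
  then have g_J: "g = (\<Sum>j\<in>J. coeff P j)" using fg(2) by simp
  then have "J \<noteq> {}" using fg(2) by auto
  then show "k \<le> n" by (auto simp: J_def)
  show "homogeneous (n - k) g"
    unfolding g_J by (rule homogeneous_sum) (auto simp: J_def P(1))
qed

lemma homogeneous_on_affine_line:
  assumes f: "homogeneous n f"
  shows "\<exists>p. degree p \<le> n \<and> coeff p n = ev f v \<and> (\<forall>s. ev f (u + s *s v) = poly p s)"
proof -
  obtain p where p: "\<And>s. ev f (u + s *s v) = poly p s" using ev_on_affine_line by blast
  obtain r where r: "\<And>t. ev f (v + t *s u) = poly r t" using ev_on_affine_line by blast
  let ?f = "monom 1 (degree r) * p" and ?g = "monom 1 n * reflect_poly r"
  have "poly (?f - ?g) s = 0" if "s \<noteq> 0" for s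
  proof -
    have "u + s *s v = s *s (v + inverse s *s u)" using that by (simp add: vec_eq_iff field_simps)
    then have "poly p s = s ^ n * poly r (inverse s)" by (metis p r homogeneous_ev[OF f])
    then show ?thesis using that by (simp add: poly_monom poly_reflect_poly_nz)
  qed
  then have "?f - ?g = 0"
    by (intro poly_eq_0_if_inj_roots[where r = "\<lambda>k::nat. of_nat (Suc k)"])
      (simp_all add: inj_def del: of_nat_Suc)
  then have coeffs: "coeff ?f (degree r + k) = coeff ?g (degree r + k)" for k by simp
  have "coeff p k = 0" if "k > n" for k
    using coeffs[of k] that by (simp add: coeff_monom_mult coeff_reflect_poly)
  then have "degree p \<le> n" by (simp add: degree_le)
  moreover have "coeff p n = coeff r 0"
    using coeffs[of n] by (simp add: coeff_monom_mult coeff_reflect_poly)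
  moreover have "coeff r 0 = ev f v" using r[of 0] by (simp add: poly_0_coeff_0)
  ultimately show ?thesis using p by (intro exI[of _ p]) simp
qed

section \<open>Points and lines of the projective plane\<close>

definition det3 :: "'a::comm_ring_1^3 \<Rightarrow> 'a^3 \<Rightarrow> 'a^3 \<Rightarrow> 'a" where
  "det3 u v w = det (vector [u, v, w])"

lemma det3_expand:
  "det3 u v w = u$1 * (v$2 * w$3 - v$3 * w$2) - u$2 * (v$1 * w$3 - v$3 * w$1)
     + u$3 * (v$1 * w$2 - v$2 * w$1)"
  by (simp add: det3_def det_3 algebra_simps)

lemma det3_add:
  "det3 (x + x') y z = det3 x y z + det3 x' y z"
  "det3 x (y + y') z = det3 x y z + det3 x y' z"
  "det3 x y (z + z') = det3 x y z + det3 x y z'"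
  by (simp_all add: det3_expand algebra_simps)

lemma det3_smult:
  "det3 (c *s x) y z = c * det3 x y z"
  "det3 x (c *s y) z = c * det3 x y z"
  "det3 x y (c *s z) = c * det3 x y z"
  by (simp_all add: det3_expand algebra_simps)

lemma det3_zero [simp]:
  "det3 0 y z = 0" "det3 x 0 z = 0" "det3 x y 0 = 0"
  by (simp_all add: det3_expand)

lemma det3_repeat [simp]:
  "det3 x x y = 0" "det3 x y x = 0" "det3 y x x = 0"
  by (simp_all add: det3_expand algebra_simps)

lemma det3_swap:
  "det3 x z y = - det3 x y z" "det3 y x z = - det3 x y z" "det3 z y x = - det3 x y z"
  by (simp_all add: det3_expand algebra_simps)

lemma det3_rotate: "det3 y z x = det3 x y z"
  by (simp add: det3_expand algebra_simps)

lemma det3_sum: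
  "det3 (sum f I) y z = (\<Sum>i\<in>I. det3 (f i) y z)"
  "det3 x (sum f I) z = (\<Sum>i\<in>I. det3 x (f i) z)"
  "det3 x y (sum f I) = (\<Sum>i\<in>I. det3 x y (f i))"
  by (induction I rule: infinite_finite_induct; simp add: det3_add)+

lemma det3_cramer:
  "det3 u v w *s x = det3 x v w *s u + det3 u x w *s v + det3 u v x *s w"
  by (simp add: vec_eq_iff forall_3 det3_expand algebra_simps)

lemma det3_neq_0_iff: "det3 u v w \<noteq> 0 \<longleftrightarrow> vec.span {u, v, w} = UNIV"
  for u v w :: "'a::field^3"
proof -
  have "rows A = (\<lambda>i. A$i) ` UNIV" for A :: "'a^3^3"
    by (auto simp: rows_def row_def vec_lambda_eta)
  then have "rows (vector [u, v, w] :: 'a^3^3) = {u, v, w}" by (simp add: UNIV_3)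
  then show ?thesis
    by (simp add: det3_def invertible_det_nz[symmetric] invertible_left_inverse
        matrix_left_invertible_span_rows_gen)
qed

lemma det3_eq_0_if_subspace:
  fixes u v w :: "'a::field^3"
  assumes "vec.subspace H" "H \<noteq> UNIV" "u \<in> H" "v \<in> H" "w \<in> H"
  shows "det3 u v w = 0"
  using assms vec.span_minimal[of "{u, v, w}" H] det3_neq_0_iff[of u v w] by auto

lemma mem_span_pair: "x \<in> vec.span {u, v} \<longleftrightarrow> (\<exists>a b. x = a *s u + b *s v)"
  by (auto simp: vec.span_insert vec.span_singleton diff_eq_eq add.commute)

lemma span_pair_eq_det3_kernel:
  assumes "det3 u v w \<noteq> 0"
  shows "vec.span {u, v} = {x. det3 u v x = 0}"
proof
  show "vec.span {u, v} \<subseteq> {x. det3 u v x = 0}"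
    by (auto simp: mem_span_pair det3_add det3_smult)
  show "{x. det3 u v x = 0} \<subseteq> vec.span {u, v}"
  proof
    fix x assume "x \<in> {x. det3 u v x = 0}"
    then have "det3 u v w *s x = det3 x v w *s u + det3 u x w *s v"
      using det3_cramer[of u v w x] by simp
    then have "det3 u v w *s x \<in> vec.span {u, v}" using mem_span_pair by blast
    then have "inverse (det3 u v w) *s (det3 u v w *s x) \<in> vec.span {u, v}"
      by (rule vec.span_scale)
    then show "x \<in> vec.span {u, v}" using assms by simp
  qed
qed

lemma proj_point_iff: "proj_point p \<longleftrightarrow> (\<exists>w. w \<noteq> 0 \<and> p = vec.span {w})"
proof
  assume p: "proj_point p"
  obtain B where B: "B \<subseteq> p" "vec.independent B" "p \<subseteq> vec.span B" "card B = vec.dim p"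
    by (rule vec.basis_exists)
  then obtain w where w: "B = {w}"
    using p by (auto simp: proj_point_def card_1_singleton_iff)
  then have "w \<noteq> 0" using B(2) vec.dependent_zero by blast
  moreover have "vec.span B \<subseteq> p" using p B(1) by (simp add: proj_point_def vec.span_minimal)
  ultimately show "\<exists>w. w \<noteq> 0 \<and> p = vec.span {w}" using B(3) w by blast
qed (auto simp: proj_point_def)

lemma proj_point_subset_eq: "proj_point p \<Longrightarrow> proj_point q \<Longrightarrow> p \<subseteq> q \<Longrightarrow> p = q"
  unfolding proj_point_def by (intro vec.subspace_dim_equal) auto

lemma proj_line_subset_eq: "proj_line H \<Longrightarrow> proj_line K \<Longrightarrow> H \<subseteq> K \<Longrightarrow> H = K"
  unfolding proj_line_def by (intro vec.subspace_dim_equal) auto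

lemma proj_line_subspace: "proj_line H \<Longrightarrow> vec.subspace H"
  by (simp add: proj_line_def)

lemma proj_line_neq_UNIV: "proj_line H \<Longrightarrow> H \<noteq> UNIV"
  using vec_dim_card[where 'a = complex and 'n = 3] by (auto simp: proj_line_def)

lemma span_singleton_subset_iff: "vec.subspace H \<Longrightarrow> vec.span {w} \<subseteq> H \<longleftrightarrow> w \<in> H"
  using vec.span_base[of w "{w}"] vec.span_minimal[of "{w}" H] by auto

lemma proj_line_eq_span_pair:
  assumes "proj_line L" "u \<in> L" "v \<in> L" "v \<noteq> 0" "u \<notin> vec.span {v}"
  shows "L = vec.span {u, v}"
proof (rule vec.subspace_dim_equal[symmetric])
  show "vec.span {u, v} \<subseteq> L" using assms by (simp add: vec.span_minimal proj_line_def)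
  show "vec.dim L \<le> vec.dim (vec.span {u, v})"
    using assms by (simp add: vec.dim_insert proj_line_def)
qed (use assms in \<open>simp_all add: proj_line_def\<close>)

lemma proj_line_extend:
  assumes "proj_line L" "v \<in> L" "v \<noteq> 0"
  obtains u where "u \<notin> vec.span {v}" "L = vec.span {u, v}"
proof -
  have "\<not> L \<subseteq> vec.span {v}"
  proof
    assume "L \<subseteq> vec.span {v}"
    then have "vec.dim L \<le> vec.dim {v}" by (rule vec.dim_mono)
    then show False using assms by (simp add: proj_line_def)
  qed
  then obtain u where "u \<in> L" "u \<notin> vec.span {v}" by blast
  then show ?thesis using that proj_line_eq_span_pair assms by blast
qed

lemma proj_line_nonzero_vector: "proj_line L \<Longrightarrow> \<exists>v\<in>L. v \<noteq> 0"
  using vec.dim_eq_0[of L] by (fastforce simp: proj_line_def)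

lemma proj_line_basis:
  assumes L: "proj_line L"
  obtains u v w where "L = vec.span {u, v}" "det3 u v w \<noteq> 0"
proof -
  obtain v where v: "v \<in> L" "v \<noteq> 0" using proj_line_nonzero_vector[OF L] by blast
  then obtain u where u: "L = vec.span {u, v}" using proj_line_extend[OF L] by metis
  obtain w where w: "w \<notin> L" using proj_line_neq_UNIV[OF L] by blast
  have "vec.dim (UNIV :: (complex^3) set) \<le> vec.dim {w, u, v}"
    using L w u by (simp add: vec.dim_insert[of w] proj_line_def vec_dim_card del: vec.dim_UNIV)
  then have "vec.span {w, u, v} = UNIV" using vec.dim_eq_span[of "{w, u, v}" UNIV] by simp
  then have "det3 w u v \<noteq> 0" by (simp only: det3_neq_0_iff not_False_eq_True)
  then show ?thesis using that[OF u] by (simp add: det3_rotate)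
qed

lemma proj_point_Int:
  assumes "proj_line H" "proj_line K" "H \<noteq> K"
  shows "proj_point (H \<inter> K)"
proof -
  have H: "vec.subspace H" "vec.dim H = 2" and K: "vec.subspace K" "vec.dim K = 2"
    using assms by (auto simp: proj_line_def)
  have HK: "vec.subspace (H \<inter> K)" using H(1) K(1) by (rule vec.subspace_inter)
  have "vec.dim (H \<inter> K) < 2"
  proof (rule ccontr)
    assume "\<not> ?thesis"
    then have "H \<inter> K = H" "H \<inter> K = K"
      using H K HK by (simp_all add: vec.subspace_dim_equal)
    then show False using assms(3) by auto
  qed
  moreover have "vec.dim {x + y |x y. x \<in> H \<and> y \<in> K} \<le> 3"
    using vec.dim_subset_UNIV[of "{x + y |x y. x \<in> H \<and> y \<in> K}"]
    by (simp add: vec.dimension_def card_cart_basis)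
  then have "vec.dim (H \<inter> K) \<ge> 1"
    using vec.dim_sums_Int[OF H(1) K(1)] H(2) K(2) by linarith
  ultimately show ?thesis using HK by (simp add: proj_point_def)
qed

lemma proj_point_eq_Int:
  assumes "proj_line H" "proj_line K" "H \<noteq> K" "proj_point p" "p \<subseteq> H" "p \<subseteq> K"
  shows "p = H \<inter> K"
  using assms proj_point_Int[of H K] proj_point_subset_eq[of p "H \<inter> K"] by simp

lemma proj_line_eq_span:
  assumes pq: "proj_point p" "proj_point q" "p \<noteq> q" and H: "proj_line H" "p \<subseteq> H" "q \<subseteq> H"
  shows "H = vec.span (p \<union> q)"
proof -
  obtain u v where uv: "v \<noteq> 0" "p = vec.span {u}" "q = vec.span {v}"
    using pq(1,2) by (auto simp: proj_point_iff)
  have "u \<notin> q"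
    using pq proj_point_subset_eq[of p q] by (auto simp: uv span_singleton_subset_iff)
  then have "H = vec.span {u, v}"
    using H uv
    by (intro proj_line_eq_span_pair) (auto simp: span_singleton_subset_iff proj_line_subspace)
  also have "\<dots> \<subseteq> vec.span (p \<union> q)"
    by (intro vec.span_mono) (auto simp: uv vec.span_base)
  finally have "H \<subseteq> vec.span (p \<union> q)" .
  moreover have "vec.span (p \<union> q) \<subseteq> H"
    using H by (intro vec.span_minimal) (auto simp: proj_line_subspace)
  ultimately show ?thesis by simp
qed

section \<open>Modular points and double points\<close>

lemma line_arrangementD:
  assumes "line_arrangement A"
  shows "finite A" "H \<in> A \<Longrightarrow> proj_line H"
  using assms by (auto simp: line_arrangement_def)

lemma line_arrangement_subset: "line_arrangement A \<Longrightarrow> T \<subseteq> A \<Longrightarrow> line_arrangement T"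
  by (auto simp: line_arrangement_def intro: finite_subset)

definition points_on :: "(complex^3) set set \<Rightarrow> (complex^3) set \<Rightarrow> (complex^3) set set" where
  "points_on A L = {q \<in> intersection_points A. q \<subseteq> L}"

lemma intersection_pointI:
  assumes "line_arrangement A" "H \<in> A" "K \<in> A" "H \<noteq> K"
  shows "H \<inter> K \<in> intersection_points A"
proof -
  have "card {H, K} \<le> point_mult A (H \<inter> K)"
    unfolding point_mult_def using assms by (intro card_mono) (auto simp: line_arrangementD)
  then show ?thesis
    using assms by (simp add: intersection_points_def proj_point_Int line_arrangementD)
qed

lemma intersection_pointE:
  assumes "p \<in> intersection_points A"
  obtains H where "H \<in> A" "H \<noteq> L" "p \<subseteq> H"
proof -
  have "card {H \<in> A. p \<subseteq> H} \<ge> 2"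
    using assms by (simp add: intersection_points_def point_mult_def)
  then have "\<not> {H \<in> A. p \<subseteq> H} \<subseteq> {L}"
    using card_mono[of "{L}" "{H \<in> A. p \<subseteq> H}"] by auto
  then show ?thesis using that by blast
qed

lemma points_on_eq:
  assumes A: "line_arrangement A" and L: "L \<in> A"
  shows "points_on A L = (\<lambda>H. H \<inter> L) ` (A - {L})"
proof
  show "points_on A L \<subseteq> (\<lambda>H. H \<inter> L) ` (A - {L})"
  proof
    fix q assume q: "q \<in> points_on A L"
    then have "q \<in> intersection_points A" by (simp add: points_on_def)
    then obtain H where H: "H \<in> A" "H \<noteq> L" "q \<subseteq> H" by (rule intersection_pointE)
    then have "q = H \<inter> L"
      using q A L by (intro proj_point_eq_Int)
        (auto simp: points_on_def intersection_points_def line_arrangementD)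
    then show "q \<in> (\<lambda>H. H \<inter> L) ` (A - {L})" using H by blast
  qed
  show "(\<lambda>H. H \<inter> L) ` (A - {L}) \<subseteq> points_on A L"
    using A L intersection_pointI by (auto simp: points_on_def)
qed

lemma finite_points_on: "line_arrangement A \<Longrightarrow> L \<in> A \<Longrightarrow> finite (points_on A L)"
  by (simp add: points_on_eq line_arrangementD)

lemma finite_intersection_points:
  assumes "line_arrangement A"
  shows "finite (intersection_points A)"
proof (rule finite_subset)
  show "intersection_points A \<subseteq> (\<Union>L\<in>A. points_on A L)"
  proof
    fix q assume q: "q \<in> intersection_points A"
    then obtain L where "L \<in> A" "q \<subseteq> L" by (rule intersection_pointE)
    then show "q \<in> (\<Union>L\<in>A. points_on A L)" using q by (auto simp: points_on_def)
  qed
qed (use assms in \<open>simp add: finite_points_on line_arrangementD\<close>)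

lemma sum_point_mult_on_line:
  assumes A: "line_arrangement A" and L: "L \<in> A"
  shows "(\<Sum>q\<in>points_on A L. point_mult A q - 1) = card A - 1"
proof -
  have fibre: "card {H \<in> A - {L}. H \<inter> L = q} = point_mult A q - 1" if q: "q \<in> points_on A L" for q
  proof -
    have "H \<inter> L = q \<longleftrightarrow> q \<subseteq> H" if "H \<in> A - {L}" for H
      using that q A L proj_point_eq_Int[of H L q]
      by (auto simp: points_on_def intersection_points_def line_arrangementD)
    then have "{H \<in> A - {L}. H \<inter> L = q} = {H \<in> A. q \<subseteq> H} - {L}" by blast
    then show ?thesis using q L by (simp add: points_on_def point_mult_def)
  qed
  have "card (A - {L}) = (\<Sum>q\<in>points_on A L. card {H \<in> A - {L}. H \<inter> L = q})"
    using sum.image_gen[of "A - {L}" "\<lambda>_. 1::nat" "\<lambda>H. H \<inter> L"] A L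
    by (simp add: points_on_eq line_arrangementD)
  also have "\<dots> = (\<Sum>q\<in>points_on A L. point_mult A q - 1)" by (rule sum.cong[OF refl fibre])
  finally show ?thesis using L by simp
qed

lemma inj_on_Int_line:
  assumes A: "line_arrangement A" and p: "proj_point p" and L: "L \<in> A" "\<not> p \<subseteq> L"
  shows "inj_on (\<lambda>H. H \<inter> L) {H \<in> A. p \<subseteq> H}"
proof (rule inj_onI, rule ccontr)
  fix H K
  assume HK: "H \<in> {H \<in> A. p \<subseteq> H}" "K \<in> {H \<in> A. p \<subseteq> H}" "H \<inter> L = K \<inter> L" "H \<noteq> K"
  then have "p = H \<inter> K" using p A by (intro proj_point_eq_Int) (auto simp: line_arrangementD)
  then have "H \<inter> L \<subseteq> p" using HK(3) by auto
  moreover have "proj_point (H \<inter> L)"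
    using HK(1) L A by (intro proj_point_Int) (auto simp: line_arrangementD)
  ultimately have "H \<inter> L = p" using p by (intro proj_point_subset_eq)
  then show False using L(2) by auto
qed

lemma modular_points_on:
  assumes A: "line_arrangement A" and p: "modular_point A p" and L: "L \<in> A" "\<not> p \<subseteq> L"
  shows "points_on A L = (\<lambda>H. H \<inter> L) ` {H \<in> A. p \<subseteq> H}"
proof
  show "points_on A L \<subseteq> (\<lambda>H. H \<inter> L) ` {H \<in> A. p \<subseteq> H}"
  proof
    fix q assume q: "q \<in> points_on A L"
    let ?K = "vec.span (p \<union> q)"
    have "q \<noteq> p" using q L by (auto simp: points_on_def)
    then have K: "?K \<in> A" using p q by (auto simp: modular_point_def points_on_def)
    have sub: "p \<subseteq> ?K" "q \<subseteq> ?K" using vec.span_superset[of "p \<union> q"] by auto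
    then have "q = ?K \<inter> L"
      using K q L A by (intro proj_point_eq_Int)
        (auto simp: points_on_def intersection_points_def line_arrangementD)
    then show "q \<in> (\<lambda>H. H \<inter> L) ` {H \<in> A. p \<subseteq> H}" using K sub by blast
  qed
  show "(\<lambda>H. H \<inter> L) ` {H \<in> A. p \<subseteq> H} \<subseteq> points_on A L"
    using L by (auto simp: points_on_eq[OF A L(1)])
qed

lemma card_points_on_modular:
  assumes "line_arrangement A" "modular_point A p" "L \<in> A" "\<not> p \<subseteq> L"
  shows "card (points_on A L) = point_mult A p"
  using assms inj_on_Int_line[of A p L]
  by (simp add: modular_points_on card_image point_mult_def modular_point_def
      intersection_points_def)

lemma non_modular_points_on:
  assumes A: "line_arrangement A" and p: "p \<in> intersection_points A" "\<not> modular_point A p"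
  obtains L where "L \<in> A" "\<not> p \<subseteq> L" "point_mult A p < card (points_on A L)"
proof -
  obtain q where q: "q \<in> intersection_points A" "q \<noteq> p" "vec.span (p \<union> q) \<notin> A"
    using p by (auto simp: modular_point_def)
  have pts: "proj_point p" "proj_point q" using p q by (auto simp: intersection_points_def)
  have not_both: "\<not> q \<subseteq> H" if "H \<in> A" "p \<subseteq> H" for H
    using that proj_line_eq_span[OF pts, of H] q A line_arrangementD(2) by auto
  obtain L where L: "L \<in> A" "q \<subseteq> L" using intersection_pointE[OF q(1)] by metis
  have pL: "\<not> p \<subseteq> L" using not_both L by blast
  let ?I = "(\<lambda>H. H \<inter> L) ` {H \<in> A. p \<subseteq> H}"
  have "q \<notin> ?I" using not_both by auto
  moreover have "?I \<subseteq> points_on A L" using pL by (auto simp: points_on_eq[OF A L(1)])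
  moreover have "q \<in> points_on A L" using q L by (simp add: points_on_def)
  ultimately have "card ?I < card (points_on A L)"
    by (intro psubset_card_mono finite_points_on[OF A L(1)]) auto
  then show ?thesis
    using that[OF L(1) pL] inj_on_Int_line[OF A pts(1) L(1) pL]
    by (simp add: card_image point_mult_def)
qed

lemma modular_line_double_points:
  assumes A: "line_arrangement A" and p: "modular_point A p" and L: "L \<in> A" "\<not> p \<subseteq> L"
  shows "2 * point_mult A p + 1 \<le> card A + card {q \<in> double_points A. q \<subseteq> L}"
proof -
  let ?D = "{q \<in> points_on A L. point_mult A q = 2}"
  have "2 * point_mult A p = (\<Sum>q\<in>points_on A L. 2)"
    by (simp add: card_points_on_modular[OF A p L])
  also have "\<dots> \<le> (\<Sum>q\<in>points_on A L. (point_mult A q - 1) + (if point_mult A q = 2 then 1 else 0))"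
    by (rule sum_mono) (auto simp: points_on_def intersection_points_def)
  also have "\<dots> = (card A - 1) + card ?D"
    by (simp add: sum.distrib sum_point_mult_on_line[OF A L(1)] sum.inter_filter[symmetric]
        finite_points_on[OF A L(1)] del: One_nat_def)
  also have "?D = {q \<in> double_points A. q \<subseteq> L}"
    by (auto simp: points_on_def double_points_def)
  finally show ?thesis using A L(1) card_gt_0_iff[of A] by (auto simp: line_arrangementD)
qed

lemma modular_double_point_unique_line:
  assumes A: "line_arrangement A" and p: "modular_point A p" and q: "q \<in> double_points A"
    and L: "L \<in> A" "q \<subseteq> L" "\<not> p \<subseteq> L" and K: "K \<in> A" "q \<subseteq> K" "\<not> p \<subseteq> K"
  shows "L = K"
proof (rule ccontr)
  assume "L \<noteq> K"
  let ?M = "vec.span (p \<union> q)"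
  have "q \<noteq> p" using L by auto
  then have "?M \<in> A" using p q by (auto simp: modular_point_def double_points_def)
  moreover have sub: "p \<subseteq> ?M" "q \<subseteq> ?M" using vec.span_superset[of "p \<union> q"] by auto
  ultimately have "card {?M, L, K} \<le> point_mult A q"
    unfolding point_mult_def using A L K by (intro card_mono) (auto simp: line_arrangementD)
  moreover have "?M \<noteq> L" "?M \<noteq> K" using L K sub by auto
  ultimately show False using q \<open>L \<noteq> K\<close> by (simp add: double_points_def)
qed

lemma card_lines_off_point:
  "finite A \<Longrightarrow> card {H \<in> A. \<not> p \<subseteq> H} = card A - point_mult A p"
  unfolding point_mult_def
  by (subst card_Diff_subset[symmetric]) (auto intro: arg_cong[where f = card])

lemma modular_double_points_bound:
  assumes A: "line_arrangement A" and p: "modular_point A p"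
  shows "(card A - point_mult A p) * (2 * point_mult A p + 1 - card A) \<le> card (double_points A)"
proof -
  define R where "R = {L \<in> A. \<not> p \<subseteq> L}"
  define D where "D L = {q \<in> double_points A. q \<subseteq> L}" for L
  have fin: "finite (double_points A)" "finite R"
    using A by (simp_all add: double_points_def R_def finite_intersection_points line_arrangementD)
  have "(card A - point_mult A p) * (2 * point_mult A p + 1 - card A)
     = (\<Sum>L\<in>R. 2 * point_mult A p + 1 - card A)"
    using A by (simp add: R_def card_lines_off_point line_arrangementD)
  also have "\<dots> \<le> (\<Sum>L\<in>R. card (D L))"
    using modular_line_double_points[OF A p]
    by (intro sum_mono) (simp add: R_def D_def le_diff_conv add.commute)
  also have "\<dots> = card (\<Union>L\<in>R. D L)"
    using fin modular_double_point_unique_line[OF A p]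
    by (intro card_UN_disjoint[symmetric]) (auto simp: R_def D_def)
  also have "\<dots> \<le> card (double_points A)"
    using fin(1) by (intro card_mono) (auto simp: D_def)
  finally show ?thesis .
qed

lemma non_pencil_line_off_vector:
  assumes A: "line_arrangement A" "\<not> pencil A" and v: "v \<noteq> 0"
  obtains H where "H \<in> A" "v \<notin> H"
proof -
  have "proj_point (vec.span {v})" using v by (auto simp: proj_point_iff)
  then obtain H where "H \<in> A" "\<not> vec.span {v} \<subseteq> H" using A(2) unfolding pencil_def by blast
  then show ?thesis
    using that A(1) by (auto simp: span_singleton_subset_iff proj_line_subspace line_arrangementD)
qed

lemma non_pencil_two_lines:
  assumes A: "line_arrangement A" "\<not> pencil A"
  obtains H K where "H \<in> A" "K \<in> A" "H \<noteq> K"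
proof -
  obtain H where H: "H \<in> A"
    using non_pencil_line_off_vector[OF A, of "axis 1 1"] by (auto simp: axis_eq_0_iff)
  then obtain v where v: "v \<in> H" "v \<noteq> 0"
    using proj_line_nonzero_vector line_arrangementD(2)[OF A(1)] by blast
  then obtain K where "K \<in> A" "v \<notin> K" using non_pencil_line_off_vector[OF A] by metis
  then show ?thesis using that[of H K] H v(1) by blast
qed

lemma max_mult_attained:
  assumes A: "line_arrangement A" "\<not> pencil A"
  obtains p where "p \<in> intersection_points A" "point_mult A p = max_mult A"
proof -
  obtain H K where "H \<in> A" "K \<in> A" "H \<noteq> K" using non_pencil_two_lines[OF A] .
  then have "H \<inter> K \<in> intersection_points A" by (rule intersection_pointI[OF A(1)])
  then have "max_mult A \<in> point_mult A ` intersection_points A"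
    unfolding max_mult_def using finite_intersection_points[OF A(1)] by (intro Max_in) auto
  then show ?thesis using that by auto
qed

section \<open>Vector fields tangent to an arrangement\<close>

definition ev_field :: "S^3 \<Rightarrow> complex^3 \<Rightarrow> complex^3" where
  "ev_field \<theta> v = (\<chi> i. ev (\<theta>$i) v)"

lemma ev_field_simps [simp]:
  "ev_field \<theta> v $ i = ev (\<theta>$i) v" "ev_field 0 v = 0"
  "ev_field (\<theta> + \<eta>) v = ev_field \<theta> v + ev_field \<eta> v" "ev_field (f *s \<theta>) v = ev f v *s ev_field \<theta> v"
  by (simp_all add: vec_eq_iff ev_field_def)

lemma ev_field_sum: "ev_field (sum f I) v = (\<Sum>i\<in>I. ev_field (f i) v)"
  by (induction I rule: infinite_finite_induct) auto

lemma ev_field_eqI: "(\<And>v. ev_field \<theta> v = ev_field \<eta> v) \<Longrightarrow> \<theta> = \<eta>"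
  by (simp add: vec_eq_iff) (metis S_eqI)

lemma ev_det3 [simp]: "ev (det3 x y z) v = det3 (ev_field x v) (ev_field y v) (ev_field z v)"
  by (simp add: det3_expand)

definition const_field :: "complex^3 \<Rightarrow> S^3" where
  "const_field w = (\<chi> i. const (w$i))"

lemma ev_field_const_field [simp]: "ev_field (const_field w) v = w"
  by (simp add: const_field_def vec_eq_iff)

lemma det3_const_field: "det3 (const_field u) (const_field v) (const_field w) = const (det3 u v w)"
  by (rule S_eqI) simp

definition euler :: "S^3" where
  "euler = vector [varx, vary, varz]"

lemma ev_field_euler [simp]: "ev_field euler v = v"
  by (simp add: euler_def vec_eq_iff forall_3)

lemma ev_euler_nth [simp]: "ev (euler$i) v = v$i"
  using ev_field_simps(1)[of euler v i] by simp

definition cross :: "'a::comm_ring_1^3 \<Rightarrow> 'a^3 \<Rightarrow> 'a^3" where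
  "cross u v = vector [u$2 * v$3 - u$3 * v$2, u$3 * v$1 - u$1 * v$3, u$1 * v$2 - u$2 * v$1]"

lemma dot3_cross [simp]: "dot3 (cross u v) w = det3 u v w"
  by (simp add: det3_expand dot3_def cross_def algebra_simps)

lemma cross_neq_0: "det3 u v w \<noteq> 0 \<Longrightarrow> cross u v \<noteq> 0"
  by (metis dot3_cross dot3_linear(6))

lemma proj_line_normal:
  assumes "proj_line H"
  shows "\<exists>a. a \<noteq> 0 \<and> H = {v. dot3 a v = 0}"
proof -
  obtain u v w where "H = vec.span {u, v}" and uvw: "det3 u v w \<noteq> 0"
    using proj_line_basis[OF assms] by metis
  then have "H = {x. dot3 (cross u v) x = 0}" using span_pair_eq_det3_kernel[OF uvw] by simp
  then show ?thesis using cross_neq_0[OF uvw] by blast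
qed

definition normal_vec :: "(complex^3) set \<Rightarrow> complex^3" where
  "normal_vec H = (SOME a. a \<noteq> 0 \<and> H = {v. dot3 a v = 0})"

lemma normal_vec:
  assumes "proj_line H"
  shows "normal_vec H \<noteq> 0" "v \<in> H \<longleftrightarrow> dot3 (normal_vec H) v = 0"
  using someI_ex[OF proj_line_normal[OF assms], folded normal_vec_def] by auto

definition line_form :: "(complex^3) set \<Rightarrow> S" where
  "line_form H = linear_form (normal_vec H)"

lemma ev_line_form_eq_0_iff: "proj_line H \<Longrightarrow> ev (line_form H) v = 0 \<longleftrightarrow> v \<in> H"
  by (simp add: line_form_def normal_vec(2))

lemma line_form_dvd_iff: "proj_line H \<Longrightarrow> line_form H dvd f \<longleftrightarrow> (\<forall>v\<in>H. ev f v = 0)"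
  by (simp add: line_form_def linear_form_dvd_iff[OF normal_vec(1)] normal_vec(2) Ball_def)

lemma homogeneous_line_form: "homogeneous 1 (line_form H)"
  unfolding line_form_def by (rule homogeneous_linear_form)

lemma prime_line_form: "proj_line H \<Longrightarrow> prime_elem (line_form H)"
  unfolding line_form_def by (rule prime_linear_form) (rule normal_vec(1))

lemma coprime_line_form_if_not_dvd: "proj_line H \<Longrightarrow> \<not> line_form H dvd f \<Longrightarrow> coprime (line_form H) f"
  by (rule prime_elem_imp_coprime) (rule prime_line_form)

lemma coprime_line_form_line_form:
  assumes "proj_line H" "proj_line K" "H \<noteq> K"
  shows "coprime (line_form H) (line_form K)"
proof (rule coprime_line_form_if_not_dvd[OF assms(1)])
  show "\<not> line_form H dvd line_form K"
    using assms proj_line_subset_eq[of H K] by (auto simp: line_form_dvd_iff ev_line_form_eq_0_iff)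
qed

lemma line_form_not_dvd_euler:
  assumes "proj_line L"
  shows "\<exists>i. \<not> line_form L dvd euler$i"
proof -
  obtain v i where "v \<in> L" "v$i \<noteq> 0"
    using proj_line_nonzero_vector[OF assms] by (auto simp: vec_eq_iff)
  then show ?thesis using assms by (auto simp: line_form_dvd_iff)
qed

definition arr_poly :: "(complex^3) set set \<Rightarrow> S" where
  "arr_poly T = (\<Prod>H\<in>T. line_form H)"

lemma homogeneous_arr_poly: "homogeneous (card T) (arr_poly T)"
  using homogeneous_prod[of T "\<lambda>_. 1" line_form] homogeneous_line_form by (simp add: arr_poly_def)

lemma arr_poly_remove: "finite T \<Longrightarrow> H \<in> T \<Longrightarrow> arr_poly T = line_form H * arr_poly (T - {H})"
  unfolding arr_poly_def by (rule prod.remove)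

lemma arr_poly_dvd_arr_poly: "finite T \<Longrightarrow> R \<subseteq> T \<Longrightarrow> arr_poly R dvd arr_poly T"
  unfolding arr_poly_def by (rule prod_dvd_prod_subset)

lemma arr_poly_neq_0: "line_arrangement T \<Longrightarrow> arr_poly T \<noteq> 0"
  using prime_elem_not_zeroI[OF prime_line_form] by (auto simp: arr_poly_def line_arrangement_def)

lemma line_form_not_dvd_arr_poly:
  assumes T: "line_arrangement T" and H: "proj_line H" "H \<notin> T"
  shows "\<not> line_form H dvd arr_poly T"
proof
  assume "line_form H dvd arr_poly T"
  moreover have "coprime (line_form H) (arr_poly T)"
    unfolding arr_poly_def using T H
    by (intro prod_coprime_right coprime_line_form_line_form) (auto simp: line_arrangementD)
  ultimately show False
    using prime_elem_not_unit[OF prime_line_form[OF H(1)]] by (simp add: coprime_absorb_left)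
qed

lemma prod_dvd_if_pairwise_coprime:
  fixes F :: "'b \<Rightarrow> 'a::semiring_gcd"
  assumes "pairwise (\<lambda>i j. coprime (F i) (F j)) I" "\<And>i. i \<in> I \<Longrightarrow> F i dvd f"
  shows "prod F I dvd f"
  using assms
proof (induction I rule: infinite_finite_induct)
  case (insert i I)
  have "coprime (F i) (prod F I)"
    using insert by (intro prod_coprime_right) (auto simp: pairwise_insert)
  moreover have "prod F I dvd f" using insert by (auto simp: pairwise_insert)
  ultimately show ?case using insert by (simp add: divides_mult)
qed auto

lemma arr_poly_dvd_iff:
  assumes T: "line_arrangement T"
  shows "arr_poly T dvd f \<longleftrightarrow> (\<forall>H\<in>T. line_form H dvd f)"
proof
  assume "arr_poly T dvd f"
  then show "\<forall>H\<in>T. line_form H dvd f"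
    using arr_poly_remove[OF line_arrangementD(1)[OF T]] dvd_mult_left by metis
next
  assume "\<forall>H\<in>T. line_form H dvd f"
  moreover have "pairwise (\<lambda>H K. coprime (line_form H) (line_form K)) T"
    using T by (intro pairwiseI coprime_line_form_line_form) (auto simp: line_arrangementD)
  ultimately show "arr_poly T dvd f"
    unfolding arr_poly_def by (intro prod_dvd_if_pairwise_coprime) auto
qed

lemma der_apply_linear_form: "ev (der_apply \<theta> (linear_form a)) v = dot3 a (ev_field \<theta> v)"
proof -
  have "linear_form a = [:[:[:0, a$1:], [:a$2:]:], [:[:a$3:]:]:]"
    by (simp add: linear_form_def const_def varx_def vary_def varz_def)
  then have "dx (linear_form a) = const (a$1)" "dy (linear_form a) = const (a$2)"
    "dz (linear_form a) = const (a$3)"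
    by (simp_all add: dx_def dy_def dz_def const_def map_poly_pCons pderiv_pCons)
  then show ?thesis by (simp add: der_apply_def dot3_def mult.commute)
qed

lemma derivation_module_iff:
  assumes A: "line_arrangement A"
  shows "\<theta> \<in> derivation_module A \<longleftrightarrow> (\<forall>H\<in>A. \<forall>v\<in>H. ev_field \<theta> v \<in> H)"
proof -
  have "(\<forall>\<alpha>. defining_form H \<alpha> \<longrightarrow> \<alpha> dvd der_apply \<theta> \<alpha>) \<longleftrightarrow> (\<forall>v\<in>H. ev_field \<theta> v \<in> H)"
    if "H \<in> A" for H
  proof -
    have H: "proj_line H" using A that by (rule line_arrangementD)
    have defining: "defining_form H \<alpha> \<longleftrightarrow> (\<exists>a. \<alpha> = linear_form a \<and> H = {v. dot3 a v = 0})" for \<alpha>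
      by (simp add: defining_form_def dot3_def)
    have tangent: "linear_form a dvd der_apply \<theta> (linear_form a) \<longleftrightarrow> (\<forall>v\<in>H. ev_field \<theta> v \<in> H)"
      if a: "H = {v. dot3 a v = 0}" for a
    proof -
      have "a \<noteq> 0" using proj_line_neq_UNIV[OF H] a by auto
      then show ?thesis by (simp add: linear_form_dvd_iff der_apply_linear_form a)
    qed
    have "H = {v. dot3 (normal_vec H) v = 0}" using normal_vec(2)[OF H] by blast
    then show ?thesis unfolding defining using tangent by metis
  qed
  then show ?thesis by (auto simp: derivation_module_def)
qed

lemma euler_mem_derivation_module: "line_arrangement A \<Longrightarrow> euler \<in> derivation_module A"
  by (simp add: derivation_module_iff)

lemma smult_const_field_mem_iff:
  assumes A: "line_arrangement A"
  shows "f *s const_field w \<in> derivation_module A \<longleftrightarrow> arr_poly {H \<in> A. w \<notin> H} dvd f"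
proof -
  have "(\<forall>v\<in>H. ev f v *s w \<in> H) \<longleftrightarrow> w \<in> H \<or> line_form H dvd f" if "H \<in> A" for H
  proof -
    have H: "proj_line H" using A that by (rule line_arrangementD)
    then have "c *s w \<in> H \<longleftrightarrow> c = 0 \<or> w \<in> H" for c by (simp add: normal_vec(2))
    then show ?thesis using H by (auto simp: line_form_dvd_iff)
  qed
  moreover have "line_arrangement {H \<in> A. w \<notin> H}"
    using A by (rule line_arrangement_subset) auto
  ultimately show ?thesis by (auto simp: derivation_module_iff[OF A] arr_poly_dvd_iff)
qed

lemma arr_poly_dvd_det3:
  assumes A: "line_arrangement A"
    and "x \<in> derivation_module A" "y \<in> derivation_module A" "z \<in> derivation_module A"
  shows "arr_poly A dvd det3 x y z"
proof -
  have "line_form H dvd det3 x y z" if H: "H \<in> A" for H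
  proof -
    have line: "proj_line H" using A H by (rule line_arrangementD)
    have "ev (det3 x y z) v = 0" if "v \<in> H" for v
      using that H assms(2-4)
        det3_eq_0_if_subspace[OF proj_line_subspace[OF line] proj_line_neq_UNIV[OF line]]
      by (simp add: derivation_module_iff[OF A])
    then show ?thesis using line by (simp add: line_form_dvd_iff)
  qed
  then show ?thesis by (simp add: arr_poly_dvd_iff[OF A])
qed

definition homogeneous_field :: "nat \<Rightarrow> S^3 \<Rightarrow> bool" where
  "homogeneous_field n \<theta> \<longleftrightarrow> (\<forall>i. homogeneous n (\<theta>$i))"

lemma homogeneous_field_ev: "homogeneous_field n \<theta> \<Longrightarrow> ev_field \<theta> (t *s v) = t ^ n *s ev_field \<theta> v"
  by (simp add: homogeneous_field_def vec_eq_iff homogeneous_ev)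

lemma homogeneous_field_euler: "homogeneous_field 1 euler"
  by (simp add: homogeneous_field_def homogeneous_def)

lemma homogeneous_field_smult_const_field:
  "homogeneous n f \<Longrightarrow> homogeneous_field n (f *s const_field w)"
  by (simp add: homogeneous_field_def homogeneous_def const_field_def)

lemma homogeneous_det3:
  assumes "homogeneous_field a x" "homogeneous_field b y" "homogeneous_field c z"
  shows "homogeneous (a + b + c) (det3 x y z)"
  unfolding homogeneous_def ev_det3
  by (simp add: assms[THEN homogeneous_field_ev] det3_smult power_add mult_ac)

lemma homogeneous_field_decomp:
  "\<exists>C N. (\<forall>k. homogeneous_field k (C k)) \<and> \<theta> = (\<Sum>k\<le>N. C k)"
proof -
  have "\<forall>i. \<exists>P :: S poly. (\<forall>k. homogeneous k (coeff P k)) \<and> poly P 1 = \<theta>$i"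
    using homogeneous_coeffs by blast
  then obtain P :: "3 \<Rightarrow> S poly"
    where P: "\<And>i k. homogeneous k (coeff (P i) k)" "\<And>i. poly (P i) 1 = \<theta>$i" by metis
  define N where "N = (\<Sum>i\<in>UNIV. degree (P i))"
  define C where "C k = (\<chi> i. coeff (P i) k)" for k
  have "\<theta>$i = (\<Sum>k\<le>N. coeff (P i) k)" for i
  proof -
    have "degree (P i) \<le> N" unfolding N_def by (rule member_le_sum) auto
    then have "poly (\<Sum>k\<le>N. monom (coeff (P i) k) k) 1 = poly (P i) 1"
      by (simp add: poly_as_sum_of_monoms')
    then show ?thesis by (simp add: P(2) poly_sum poly_monom)
  qed
  then have "\<theta> = (\<Sum>k\<le>N. C k)" by (simp add: vec_eq_iff sum_component C_def)
  moreover have "homogeneous_field k (C k)" for k by (simp add: homogeneous_field_def C_def P(1))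
  ultimately show ?thesis by blast
qed

lemma homogeneous_component_mem_derivation_module:
  assumes A: "line_arrangement A" and C: "\<And>k. homogeneous_field k (C k)"
    and sum: "(\<Sum>k\<le>N. C k) \<in> derivation_module A" and k: "k \<le> N"
  shows "C k \<in> derivation_module A"
  unfolding derivation_module_iff[OF A]
proof (intro ballI)
  fix H v assume H: "H \<in> A" and v: "v \<in> H"
  note line = line_arrangementD(2)[OF A H]
  have "\<forall>t. (\<Sum>k\<le>N. dot3 (normal_vec H) (ev_field (C k) v) * t ^ k) = 0"
  proof
    fix t
    have "t *s v \<in> H" using v line by (simp add: proj_line_subspace vec.subspace_scale)
    then have "ev_field (\<Sum>k\<le>N. C k) (t *s v) \<in> H"
      using sum H by (simp add: derivation_module_iff[OF A])
    then show "(\<Sum>k\<le>N. dot3 (normal_vec H) (ev_field (C k) v) * t ^ k) = 0"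
      by (simp add: normal_vec(2)[OF line] ev_field_sum dot3_sum homogeneous_field_ev[OF C]
          mult.commute)
  qed
  then have "dot3 (normal_vec H) (ev_field (C k) v) = 0"
    using k by (metis polyfun_eq_0)
  then show "ev_field (C k) v \<in> H" by (simp add: normal_vec(2)[OF line])
qed

lemma derivation_module_homogeneous_decomp:
  assumes A: "line_arrangement A" and \<theta>: "\<theta> \<in> derivation_module A"
  obtains C N where "\<And>k. homogeneous_field k (C k)" "\<And>k. k \<le> N \<Longrightarrow> C k \<in> derivation_module A"
    "\<theta> = (\<Sum>k\<le>N. C k)"
  using homogeneous_field_decomp[of \<theta>] homogeneous_component_mem_derivation_module[OF A] \<theta> by metis

lemma card_le_degree_det3:
  assumes A: "line_arrangement A"
    and D: "x \<in> derivation_module A" "y \<in> derivation_module A" "z \<in> derivation_module A"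
    and hom: "homogeneous_field a x" "homogeneous_field b y" "homogeneous_field c z"
    and det: "det3 x y z \<noteq> 0"
  shows "card A \<le> a + b + c"
proof -
  obtain g where "det3 x y z = arr_poly A * g" using arr_poly_dvd_det3[OF A D] by (auto elim: dvdE)
  then show ?thesis
    using homogeneous_factor(1)[OF homogeneous_arr_poly] homogeneous_det3[OF hom] det by metis
qed

section \<open>Saito's criterion\<close>

lemma dvd_det3_span:
  assumes B: "\<And>x y z. x \<in> B \<Longrightarrow> y \<in> B \<Longrightarrow> z \<in> B \<Longrightarrow> k dvd det3 x y z"
    and xyz: "x \<in> DerS.span B" "y \<in> DerS.span B" "z \<in> DerS.span B"
  shows "k dvd det3 x y z"
proof -
  have first: "k dvd det3 x y z" if "x \<in> DerS.span B" "y \<in> B" "z \<in> B" for x y z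
    using that(1)
    by (induction rule: DerS.span_induct_alt) (use B that in \<open>auto simp: det3_add det3_smult\<close>)
  have second: "k dvd det3 x y z" if "x \<in> DerS.span B" "y \<in> DerS.span B" "z \<in> B" for x y z
    using that(2)
    by (induction rule: DerS.span_induct_alt) (use first that in \<open>auto simp: det3_add det3_smult\<close>)
  show ?thesis
    using xyz(3)
    by (induction rule: DerS.span_induct_alt) (use second xyz in \<open>auto simp: det3_add det3_smult\<close>)
qed

lemma independent_subset_triple:
  assumes indep: "DerS.independent B" and b: "b1 \<in> B" "b2 \<in> B" "b3 \<in> B"
    and det: "det3 b1 b2 b3 \<noteq> 0"
  shows "B = {b1, b2, b3}"
proof (rule ccontr)
  assume "B \<noteq> {b1, b2, b3}"
  then obtain x where x: "x \<in> B" "x \<noteq> b1" "x \<noteq> b2" "x \<noteq> b3" using b by auto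
  have distinct: "b1 \<noteq> b2" "b1 \<noteq> b3" "b2 \<noteq> b3" using det by auto
  define c where "c = (\<lambda>_. 0)(x := det3 b1 b2 b3, b1 := - det3 x b2 b3, b2 := - det3 b1 x b3,
    b3 := - det3 b1 b2 x)"
  have "(\<Sum>v\<in>{x, b1, b2, b3}. c v *s v) = 0"
    using distinct x det3_cramer[of b1 b2 b3 x] by (simp add: c_def)
  moreover have "c x \<noteq> 0" using x det by (simp add: c_def)
  ultimately have "DerS.dependent B"
    unfolding DerS.dependent_explicit using x b
    by (intro exI[of _ "{x, b1, b2, b3}"] exI[of _ c]) auto
  then show False using indep by simp
qed

text \<open>In the basis consisting of two vectors of \<open>H\<close> and a vector off \<open>H\<close>, it suffices to multiply the
  first two by the forms of the other lines.\<close>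

lemma tangent_triple_at_line:
  assumes A: "line_arrangement A" and H: "H \<in> A"
  obtains x y z c where "x \<in> derivation_module A" "y \<in> derivation_module A"
    "z \<in> derivation_module A" "c \<noteq> 0"
    "det3 x y z = const c * (arr_poly (A - {H}) ^ 2 * arr_poly A)"
proof -
  obtain u v w where uv: "H = vec.span {u, v}" and uvw: "det3 u v w \<noteq> 0"
    using proj_line_basis line_arrangementD(2)[OF A H] by metis
  let ?Q = "arr_poly (A - {H})"
  have fin: "finite A" using A by (rule line_arrangementD)
  have "u \<in> H" "v \<in> H" using vec.span_base[of _ "{u, v}"] by (auto simp: uv)
  then have "?Q *s const_field u \<in> derivation_module A" "?Q *s const_field v \<in> derivation_module A"
    "arr_poly A *s const_field w \<in> derivation_module A"
    using fin by (auto simp: smult_const_field_mem_iff[OF A] intro!: arr_poly_dvd_arr_poly)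
  moreover have "det3 (?Q *s const_field u) (?Q *s const_field v) (arr_poly A *s const_field w)
      = const (det3 u v w) * (?Q ^ 2 * arr_poly A)"
    by (simp add: det3_smult det3_const_field power2_eq_square mult_ac)
  ultimately show ?thesis using that uvw by blast
qed

lemma free_arrangement_triple:
  assumes A: "line_arrangement A" "A \<noteq> {}" and free: "free_arrangement A"
  obtains b1 b2 b3 where "b1 \<in> derivation_module A" "b2 \<in> derivation_module A"
    "b3 \<in> derivation_module A" "det3 b1 b2 b3 \<noteq> 0"
    "\<And>x y z. x \<in> derivation_module A \<Longrightarrow> y \<in> derivation_module A \<Longrightarrow> z \<in> derivation_module A
      \<Longrightarrow> det3 b1 b2 b3 dvd det3 x y z"
proof -
  obtain B where indep: "DerS.independent B" and span: "DerS.span B = derivation_module A"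
    using free by (auto simp: free_arrangement_def)
  have "\<exists>b1\<in>B. \<exists>b2\<in>B. \<exists>b3\<in>B. det3 b1 b2 b3 \<noteq> 0"
  proof (rule ccontr)
    assume "\<not> ?thesis"
    then have "0 dvd det3 x y z" if "x \<in> B" "y \<in> B" "z \<in> B" for x y z
      using that by auto
    then have zero: "0 dvd det3 x y z"
      if "x \<in> derivation_module A" "y \<in> derivation_module A" "z \<in> derivation_module A" for x y z
      using dvd_det3_span[of B 0] that by (simp only: span)
    obtain H where "H \<in> A" using A(2) by blast
    then obtain x y z c where "x \<in> derivation_module A" "y \<in> derivation_module A"
      "z \<in> derivation_module A" "c \<noteq> 0" and
      xyz: "det3 x y z = const c * (arr_poly (A - {H}) ^ 2 * arr_poly A)"
      using tangent_triple_at_line[OF A(1)] by metis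
    then have "const c * (arr_poly (A - {H}) ^ 2 * arr_poly A) = 0"
      using zero[of x y z] by simp
    moreover have "line_arrangement (A - {H})" using A(1) by (rule line_arrangement_subset) auto
    ultimately show False using \<open>c \<noteq> 0\<close> A(1) arr_poly_neq_0 by auto
  qed
  then obtain b1 b2 b3 where b: "b1 \<in> B" "b2 \<in> B" "b3 \<in> B" and det: "det3 b1 b2 b3 \<noteq> 0"
    by blast
  have B: "B = {b1, b2, b3}" by (rule independent_subset_triple[OF indep b det])
  have "det3 b1 b2 b3 dvd det3 x y z" if "x \<in> B" "y \<in> B" "z \<in> B" for x y z
    using that unfolding B
    by (auto simp: det3_swap[of b1 b3 b2] det3_swap[of b2 b1 b3] det3_swap[of b3 b2 b1]
        det3_rotate[of b2 b3 b1] det3_rotate[of b3 b1 b2])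
  then have "det3 b1 b2 b3 dvd det3 x y z"
    if "x \<in> derivation_module A" "y \<in> derivation_module A" "z \<in> derivation_module A" for x y z
    using dvd_det3_span[of B "det3 b1 b2 b3"] that by (simp only: span)
  moreover have "B \<subseteq> derivation_module A" using DerS.span_superset[of B] span by simp
  ultimately show ?thesis using that[of b1 b2 b3] b det by blast
qed

lemma free_arrangement_det3_eq_arr_poly:
  assumes A: "line_arrangement A" "A \<noteq> {}" and free: "free_arrangement A"
  obtains b1 b2 b3 c where "b1 \<in> derivation_module A" "b2 \<in> derivation_module A"
    "b3 \<in> derivation_module A" "c \<noteq> 0" "det3 b1 b2 b3 = const c * arr_poly A"
proof -
  obtain b1 b2 b3 where b: "b1 \<in> derivation_module A" "b2 \<in> derivation_module A"
    "b3 \<in> derivation_module A"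
    and dvd: "\<And>x y z. x \<in> derivation_module A \<Longrightarrow> y \<in> derivation_module A \<Longrightarrow> z \<in> derivation_module A
      \<Longrightarrow> det3 b1 b2 b3 dvd det3 x y z"
    using free_arrangement_triple[OF assms] by metis
  obtain g where g: "det3 b1 b2 b3 = arr_poly A * g"
    using arr_poly_dvd_det3[OF A(1) b(1-3)] by (auto elim: dvdE)
  have g_dvd: "g dvd arr_poly (A - {H}) ^ 2" if H: "H \<in> A" for H
  proof -
    obtain x y z c where xyz: "x \<in> derivation_module A" "y \<in> derivation_module A"
      "z \<in> derivation_module A" and c: "c \<noteq> 0"
      and det: "det3 x y z = const c * (arr_poly (A - {H}) ^ 2 * arr_poly A)"
      using tangent_triple_at_line[OF A(1) H] by metis
    have "arr_poly A * g dvd arr_poly A * (const c * arr_poly (A - {H}) ^ 2)"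
      using dvd[OF xyz] by (simp add: g det mult_ac)
    then have "g dvd const c * arr_poly (A - {H}) ^ 2" using arr_poly_neq_0[OF A(1)] by simp
    moreover have "is_unit (const c)" using c is_unit_S_iff by blast
    ultimately show ?thesis by (simp add: dvd_mult_unit_iff')
  qed
  have "coprime (line_form H) g" if H: "H \<in> A" for H
  proof (rule coprime_line_form_if_not_dvd)
    show line: "proj_line H" using A(1) H by (rule line_arrangementD)
    have "line_arrangement (A - {H})" using A(1) by (rule line_arrangement_subset) auto
    then have "\<not> line_form H dvd arr_poly (A - {H}) ^ 2"
      using line_form_not_dvd_arr_poly[OF _ line] prime_line_form[OF line]
      by (simp add: prime_elem_dvd_power_iff)
    then show "\<not> line_form H dvd g" using g_dvd[OF H] dvd_trans by blast
  qed
  then have "coprime g (arr_poly (A - {H}) ^ 2)" for H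
    unfolding arr_poly_def
    by (intro coprime_power_right_iff[THEN iffD2] disjI1 prod_coprime_right)
      (auto simp: coprime_commute)
  moreover obtain H where "H \<in> A" using A(2) by blast
  ultimately have "g dvd 1" using g_dvd by (metis coprime_absorb_left)
  then obtain c where "c \<noteq> 0" "g = const c" using is_unit_S_iff by blast
  then show ?thesis using that[OF b] g by (simp add: mult.commute)
qed

lemma free_arrangement_homogeneous_triple:
  assumes A: "line_arrangement A" "A \<noteq> {}" and free: "free_arrangement A"
  obtains x y z a b c where "x \<in> derivation_module A" "y \<in> derivation_module A"
    "z \<in> derivation_module A" "homogeneous_field a x" "homogeneous_field b y" "homogeneous_field c z"
    "a + b + c = card A" "det3 x y z \<noteq> 0"
proof -
  obtain x y z r where D: "x \<in> derivation_module A" "y \<in> derivation_module A"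
      "z \<in> derivation_module A"
    and r: "r \<noteq> 0" and det: "det3 x y z = const r * arr_poly A"
    using free_arrangement_det3_eq_arr_poly[OF assms] by metis
  obtain X L where X: "\<And>k. homogeneous_field k (X k)" "\<And>k. k \<le> L \<Longrightarrow> X k \<in> derivation_module A"
    "x = (\<Sum>k\<le>L. X k)" using derivation_module_homogeneous_decomp[OF A(1) D(1)] by metis
  obtain Y M where Y: "\<And>k. homogeneous_field k (Y k)" "\<And>k. k \<le> M \<Longrightarrow> Y k \<in> derivation_module A"
    "y = (\<Sum>k\<le>M. Y k)" using derivation_module_homogeneous_decomp[OF A(1) D(2)] by metis
  obtain Z N where Z: "\<And>k. homogeneous_field k (Z k)" "\<And>k. k \<le> N \<Longrightarrow> Z k \<in> derivation_module A"
    "z = (\<Sum>k\<le>N. Z k)" using derivation_module_homogeneous_decomp[OF A(1) D(3)] by metis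
  define T where "T = {..L} \<times> {..M} \<times> {..N}"
  define h where "h = (\<lambda>(i, j, k). det3 (X i) (Y j) (Z k))"
  define e :: "nat \<times> nat \<times> nat \<Rightarrow> nat" where "e = (\<lambda>(i, j, k). i + j + k)"
  have det_sum: "det3 x y z = sum h T"
    unfolding X(3) Y(3) Z(3) T_def h_def
    by (simp only: det3_sum(1), simp only: det3_sum(2), simp only: det3_sum(3) sum.cartesian_product)
  have "homogeneous (0 + card A) (det3 x y z)"
    unfolding det by (intro homogeneous_mult homogeneous_const homogeneous_arr_poly)
  then have "det3 x y z = (\<Sum>t\<in>{t\<in>T. e t = card A}. h t)"
    unfolding det_sum
    by (intro homogeneous_sum_component)
      (auto simp: T_def e_def h_def intro: homogeneous_det3 X(1) Y(1) Z(1))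
  moreover have "det3 x y z \<noteq> 0" using r arr_poly_neq_0[OF A(1)] by (simp add: det)
  ultimately obtain t where "t \<in> T" "e t = card A" "h t \<noteq> 0"
    by (auto elim!: sum.not_neutral_contains_not_neutral)
  then obtain i j k where "i \<le> L" "j \<le> M" "k \<le> N" "i + j + k = card A"
    "det3 (X i) (Y j) (Z k) \<noteq> 0"
    by (auto simp: T_def e_def h_def)
  then show ?thesis using that[OF X(2) Y(2) Z(2) X(1) Y(1) Z(1)] by simp
qed

lemma homogeneous_field_0_mem_imp_0:
  assumes A: "line_arrangement A" "\<not> pencil A"
    and \<theta>: "\<theta> \<in> derivation_module A" "homogeneous_field 0 \<theta>"
  shows "\<theta> = 0"
proof (rule ccontr)
  define w where "w = ev_field \<theta> 0"
  have const: "ev_field \<theta> v = w" for v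
    using homogeneous_field_ev[OF \<theta>(2), of 0 v] by (simp add: w_def)
  assume "\<theta> \<noteq> 0"
  then have "w \<noteq> 0" using ev_field_eqI[of \<theta> 0] const by auto
  then obtain H where H: "H \<in> A" "w \<notin> H" using non_pencil_line_off_vector[OF A] by metis
  then have "0 \<in> H"
    using A(1) by (simp add: vec.subspace_0 proj_line_subspace line_arrangementD)
  then show False using \<theta>(1) H const by (auto simp: derivation_module_iff[OF A(1)])
qed

lemma euler_exchange:
  assumes "det3 x y z \<noteq> 0"
  obtains "det3 euler x y \<noteq> 0" | "det3 euler x z \<noteq> 0" | "det3 euler y z \<noteq> 0"
proof -
  have "euler \<noteq> 0"
    using ev_field_euler[of "axis 1 1"] by (metis axis_eq_0_iff ev_field_simps(2) zero_neq_one)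
  then have "det3 x y z *s euler \<noteq> 0" using assms by (auto simp: vec_eq_iff)
  then have "det3 euler y z \<noteq> 0 \<or> det3 x euler z \<noteq> 0 \<or> det3 x y euler \<noteq> 0"
    unfolding det3_cramer[of x y z euler] by auto
  then show ?thesis
    using that det3_swap(2)[of x euler z] det3_rotate[of x y euler] by auto
qed

lemma free_arrangement_euler_basis:
  assumes A: "line_arrangement A" "\<not> pencil A" and free: "free_arrangement A"
  obtains x y a b where "x \<in> derivation_module A" "y \<in> derivation_module A"
    "homogeneous_field a x" "homogeneous_field b y" "1 + a + b = card A" "a \<le> b"
    "det3 euler x y \<noteq> 0"
proof -
  have "A \<noteq> {}" using non_pencil_two_lines[OF A] by blast
  then obtain x y z a b c where D: "x \<in> derivation_module A" "y \<in> derivation_module A"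
      "z \<in> derivation_module A"
    and hom: "homogeneous_field a x" "homogeneous_field b y" "homogeneous_field c z"
    and deg: "a + b + c = card A" and det: "det3 x y z \<noteq> 0"
    using free_arrangement_homogeneous_triple[OF A(1) _ free] by metis
  have pos: "a > 0" "b > 0" "c > 0"
    using D hom det homogeneous_field_0_mem_imp_0[OF A(1,2)] by (metis det3_zero gr0I)+
  note ordered = that
  have basis: thesis if xy: "x \<in> derivation_module A" "y \<in> derivation_module A"
    "homogeneous_field a x" "homogeneous_field b y" "1 + a + b \<le> card A"
    "det3 euler x y \<noteq> 0" for x y a b
  proof -
    have "card A \<le> 1 + a + b"
      using card_le_degree_det3[OF A(1) euler_mem_derivation_module[OF A(1)] xy(1,2)
          homogeneous_field_euler xy(3,4,6)] .
    then have "1 + a + b = card A" using xy(5) by simp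
    moreover have "det3 euler y x \<noteq> 0" using xy(6) det3_swap(1)[of euler y x] by simp
    ultimately show thesis
      using ordered[OF xy(1,2,3,4)] ordered[OF xy(2,1,4,3)] xy(6) by (cases "a \<le> b") simp_all
  qed
  from det show thesis
  proof (cases rule: euler_exchange)
    case 1
    then show ?thesis using basis[OF D(1,2) hom(1,2)] deg pos by simp
  next
    case 2
    then show ?thesis using basis[OF D(1,3) hom(1,3)] deg pos by simp
  next
    case 3
    then show ?thesis using basis[OF D(2,3) hom(2,3)] deg pos by simp
  qed
qed

section \<open>Fields that are radial along a line\<close>

definition radial_on :: "(complex^3) set \<Rightarrow> S^3 \<Rightarrow> bool" where
  "radial_on L \<theta> \<longleftrightarrow> (\<forall>v\<in>L. \<forall>i j. ev (\<theta>$i) v * v$j = ev (\<theta>$j) v * v$i)"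

lemma proj_point_eq_span: "proj_point q \<Longrightarrow> x \<in> q \<Longrightarrow> x \<noteq> 0 \<Longrightarrow> q = vec.span {x}"
  using proj_point_subset_eq[of "vec.span {x}" q] span_singleton_subset_iff[of q x]
  by (auto simp: proj_point_iff)

lemma proj_point_meets_affine_line:
  assumes q: "proj_point q" "q \<subseteq> vec.span {u, v}" "v \<notin> q"
  shows "\<exists>s. u + s *s v \<in> q"
proof -
  have sub: "vec.subspace q" using q(1) by (simp add: proj_point_def)
  obtain x where x: "x \<noteq> 0" "q = vec.span {x}" using q(1) by (auto simp: proj_point_iff)
  have xq: "x \<in> q" by (simp add: x(2) vec.span_base)
  then obtain a b where ab: "x = a *s u + b *s v" using q(2) mem_span_pair by blast
  have "a \<noteq> 0"
  proof
    assume "a = 0"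
    then have "v = inverse b *s x" using ab x(1) by simp
    then show False using vec.subspace_scale[OF sub xq] q(3) by simp
  qed
  then have "u + (b / a) *s v = inverse a *s x" by (simp add: ab vec_eq_iff field_simps)
  then show ?thesis using vec.subspace_scale[OF sub xq] by metis
qed

text \<open>If \<open>f v \<noteq> 0\<close> for some \<open>v \<in> L\<close>, take \<open>v\<close> as the point at infinity of \<open>L\<close>: then \<open>f\<close> restricts
  to a polynomial of degree exactly \<open>n\<close> on the affine line \<open>u + \<complex> v\<close>, which meets every point of
  \<open>P\<close>.\<close>

lemma homogeneous_vanishes_on_line:
  assumes f: "homogeneous n f" and L: "proj_line L" and P: "finite P" "n < card P"
    and pts: "\<And>q. q \<in> P \<Longrightarrow> proj_point q" "\<And>q. q \<in> P \<Longrightarrow> q \<subseteq> L"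
    and zero: "\<And>q x. q \<in> P \<Longrightarrow> x \<in> q \<Longrightarrow> ev f x = 0" and v: "v \<in> L"
  shows "ev f v = 0"
proof (rule ccontr)
  assume fv: "ev f v \<noteq> 0"
  obtain q where "q \<in> P" using P by fastforce
  then have "0 \<in> q" using pts(1) by (auto simp: proj_point_def intro: vec.subspace_0)
  then have "v \<noteq> 0" using fv zero \<open>q \<in> P\<close> by blast
  then obtain u where u: "u \<notin> vec.span {v}" "L = vec.span {u, v}"
    using proj_line_extend[OF L v] by metis
  have "\<exists>s. u + s *s v \<in> q" if "q \<in> P" for q
    using that pts zero fv u(2) by (intro proj_point_meets_affine_line) auto
  then obtain s where s: "\<And>q. q \<in> P \<Longrightarrow> u + s q *s v \<in> q" by metis
  have "inj_on s P"
  proof (rule inj_onI)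
    fix q q' assume q: "q \<in> P" "q' \<in> P" "s q = s q'"
    have "u + s q *s v \<noteq> 0"
    proof
      assume "u + s q *s v = 0"
      then have "u = (- s q) *s v" by (simp add: eq_neg_iff_add_eq_0)
      then show False using u(1) unfolding vec.span_singleton by blast
    qed
    then show "q = q'" using q s[of q] s[of q'] pts(1) proj_point_eq_span by metis
  qed
  obtain p where p: "degree p \<le> n" "coeff p n = ev f v" "\<And>s. ev f (u + s *s v) = poly p s"
    using homogeneous_on_affine_line[OF f] by metis
  then have "p \<noteq> 0" using fv by auto
  have "s ` P \<subseteq> {t. poly p t = 0}" using s zero by (auto simp flip: p(3))
  then have "card (s ` P) \<le> card {t. poly p t = 0}"
    using poly_roots_finite[OF \<open>p \<noteq> 0\<close>] by (rule card_mono[rotated])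
  also have "\<dots> \<le> n" using card_poly_roots_bound[OF \<open>p \<noteq> 0\<close>] p(1) by simp
  finally show False using P(2) \<open>inj_on s P\<close> by (simp add: card_image)
qed

lemma radial_on_if_many_points:
  assumes A: "line_arrangement A" and L: "L \<in> A"
    and \<theta>: "\<theta> \<in> derivation_module A" "homogeneous_field n \<theta>" and n: "n + 1 < card (points_on A L)"
  shows "radial_on L \<theta>"
  unfolding radial_on_def
proof (intro ballI allI)
  fix v i j assume v: "v \<in> L"
  define f where "f = \<theta>$i * euler$j - \<theta>$j * euler$i"
  have hom: "homogeneous (n + 1) f"
    unfolding f_def using \<theta>(2) homogeneous_field_euler
    by (intro homogeneous_diff homogeneous_mult) (auto simp: homogeneous_field_def)
  have f_zero: "ev f x = 0" if q: "q \<in> points_on A L" and x: "x \<in> q" for q x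
  proof -
    obtain H where H: "H \<in> A" "q = H \<inter> L" using q points_on_eq[OF A L] by auto
    have "ev_field \<theta> x \<in> q"
      using \<theta>(1) L H x by (auto simp: derivation_module_iff[OF A])
    moreover obtain w where "q = vec.span {w}"
      using q by (auto simp: points_on_def intersection_points_def proj_point_iff)
    ultimately obtain c c' where "x = c *s w" "ev_field \<theta> x = c' *s w"
      using x by (auto simp: vec.span_singleton)
    then have "x$i = c * w$i" "x$j = c * w$j" "ev (\<theta>$i) x = c' * w$i" "ev (\<theta>$j) x = c' * w$j"
      by (simp_all add: vec_eq_iff)
    then show ?thesis by (simp add: f_def)
  qed
  have "ev f v = 0"
    by (rule homogeneous_vanishes_on_line[OF hom line_arrangementD(2)[OF A L]
          finite_points_on[OF A L] n])
      (use f_zero v in \<open>auto simp: points_on_def intersection_points_def\<close>)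
  then show "ev (\<theta>$i) v * v$j = ev (\<theta>$j) v * v$i" by (simp add: f_def)
qed

lemma dvd_vecE:
  fixes x :: "'a::comm_ring_1^'n"
  assumes "\<And>j. a dvd x$j"
  obtains y where "x = a *s y"
proof -
  obtain y where "\<And>j. x$j = a * y j" using assms unfolding dvd_def by metis
  then have "x = a *s (\<chi> j. y j)" by (simp add: vec_eq_iff)
  then show ?thesis by (rule that)
qed

lemma radial_on_square_dvd:
  assumes L: "proj_line L" and radial: "radial_on L \<theta>" "radial_on L \<eta>"
  shows "line_form L ^ 2 dvd det3 euler \<theta> \<eta>"
proof -
  obtain i where i: "\<not> line_form L dvd euler$i" using line_form_not_dvd_euler[OF L] by blast
  have decomp: "\<exists>\<psi>. euler$i *s \<theta> = \<theta>$i *s euler + line_form L *s \<psi>" if "radial_on L \<theta>" for \<theta>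
  proof -
    have "line_form L dvd (euler$i *s \<theta> - \<theta>$i *s euler)$j" for j
      using that L by (auto simp: line_form_dvd_iff radial_on_def mult.commute)
    then obtain \<psi> where "euler$i *s \<theta> - \<theta>$i *s euler = line_form L *s \<psi>" by (rule dvd_vecE)
    then show ?thesis by (metis add.commute diff_add_cancel)
  qed
  obtain \<psi> where \<psi>: "euler$i *s \<theta> = \<theta>$i *s euler + line_form L *s \<psi>"
    using decomp[OF radial(1)] by blast
  obtain \<phi> where \<phi>: "euler$i *s \<eta> = \<eta>$i *s euler + line_form L *s \<phi>"
    using decomp[OF radial(2)] by blast
  have "euler$i ^ 2 * det3 euler \<theta> \<eta> = det3 euler (euler$i *s \<theta>) (euler$i *s \<eta>)"
    by (simp add: det3_smult power2_eq_square mult_ac)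
  also have "\<dots> = line_form L ^ 2 * det3 euler \<psi> \<phi>"
    unfolding \<psi> \<phi> by (simp add: det3_add det3_smult power2_eq_square)
  finally have "line_form L ^ 2 dvd euler$i ^ 2 * det3 euler \<theta> \<eta>" by simp
  moreover have "coprime (line_form L ^ 2) (euler$i ^ 2)"
    using coprime_line_form_if_not_dvd[OF L i] by simp
  ultimately show ?thesis by (simp add: coprime_dvd_mult_right_iff)
qed

lemma card_le_degree_if_radial:
  assumes A: "line_arrangement A" and L: "L \<in> A"
    and D: "x \<in> derivation_module A" "y \<in> derivation_module A"
    and hom: "homogeneous_field a x" "homogeneous_field b y"
    and radial: "radial_on L x" "radial_on L y" and det: "det3 euler x y \<noteq> 0"
  shows "card A \<le> a + b"
proof -
  let ?\<alpha> = "line_form L" and ?Q = "arr_poly (A - {L})"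
  have line: "proj_line L" and fin: "finite A" using A L by (simp_all add: line_arrangementD)
  have Q: "arr_poly A = ?\<alpha> * ?Q" by (rule arr_poly_remove[OF fin L])
  have "coprime ?\<alpha> ?Q"
    using line line_arrangement_subset[OF A, of "A - {L}"]
    by (intro coprime_line_form_if_not_dvd line_form_not_dvd_arr_poly) auto
  then have "coprime (?\<alpha> ^ 2) ?Q" by simp
  moreover have "?Q dvd det3 euler x y"
    using arr_poly_dvd_det3[OF A euler_mem_derivation_module[OF A] D]
    by (auto simp: Q dvd_mult_right)
  ultimately have "?\<alpha> ^ 2 * ?Q dvd det3 euler x y"
    using radial_on_square_dvd[OF line radial] by (simp add: divides_mult)
  then have "?\<alpha> * arr_poly A dvd det3 euler x y" by (simp add: Q power2_eq_square mult_ac)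
  then obtain g where "det3 euler x y = ?\<alpha> * arr_poly A * g" by (auto elim: dvdE)
  moreover have "homogeneous (1 + a + b) (det3 euler x y)"
    by (rule homogeneous_det3[OF homogeneous_field_euler hom])
  ultimately have "1 + card A \<le> 1 + a + b"
    using homogeneous_factor(1)[OF homogeneous_mult[OF homogeneous_line_form homogeneous_arr_poly]]
      det by metis
  then show ?thesis by simp
qed

section \<open>Free arrangements with a point of large multiplicity\<close>

lemma det3_pluecker:
  "det3 u v w * det3 x y w = det3 x v w * det3 u y w - det3 u x w * det3 y v w"
  by (simp add: det3_expand algebra_simps)

lemma det3_extend:
  fixes w :: "'a::field^3"
  assumes "w \<noteq> 0"
  obtains u v where "det3 u v w = 1"
proof -
  obtain i where "w$i \<noteq> 0" using assms by (auto simp: vec_eq_iff)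
  moreover have "det3 (axis 2 1) (axis 3 1) w = w$1" "det3 (axis 3 1) (axis 1 1) w = w$2"
    "det3 (axis 1 1) (axis 2 1) w = w$3"
    by (simp_all add: det3_expand axis_def)
  ultimately obtain u v where uv: "det3 u v w \<noteq> 0" using exhaust_3[of i] by metis
  then have "det3 (inverse (det3 u v w) *s u) v w = 1" by (simp add: det3_smult)
  then show ?thesis by (rule that)
qed

text \<open>In a basis \<open>u, v, w\<close>, the coordinates of \<open>E\<close> at \<open>u\<close> and \<open>v\<close> are coprime linear forms, so the
  proportional coordinates of \<open>\<theta>\<close> are a common multiple of them.\<close>

lemma euler_const_field_decomp:
  assumes w: "w \<noteq> 0" and det: "det3 euler \<theta> (const_field w) = 0"
  obtains g h where "\<theta> = h *s euler + g *s const_field w"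
proof -
  obtain u v where uvw: "det3 u v w = 1" using det3_extend[OF w] by metis
  define U V W where "U = const_field u" and "V = const_field v" and "W = const_field w"
  have "det3 U V W = const 1" by (simp add: U_def V_def W_def det3_const_field uvw)
  also have "const 1 = 1" by (rule S_eqI) simp
  finally have UVW: "det3 U V W = 1" .
  have coords: "x = det3 x V W *s U + det3 U x W *s V + det3 U V x *s W" for x
    using det3_cramer[of U V W x] by (simp add: UVW)
  let ?\<xi> = "linear_form (cross v w)" and ?\<eta> = "linear_form (cross w u)"
  have \<xi>: "det3 euler V W = ?\<xi>" and \<eta>: "det3 U euler W = ?\<eta>"
    by (rule S_eqI, simp add: V_def W_def U_def det3_rotate[of v w] det3_rotate[of u _ w])+
  have eq: "?\<xi> * det3 U \<theta> W = ?\<eta> * det3 \<theta> V W"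
    using det3_pluecker[of U V W euler \<theta>] det by (simp add: W_def flip: \<xi> \<eta>)
  have nonzero: "cross v w \<noteq> 0" by (rule cross_neq_0[of v w u]) (simp add: det3_rotate[of v w u] uvw)
  have "\<not> ?\<xi> dvd ?\<eta>"
    using uvw
    by (auto simp: linear_form_dvd_iff[OF nonzero] det3_rotate[of u v w, symmetric]
        intro!: exI[of _ v])
  then have "?\<xi> dvd det3 \<theta> V W"
    using eq prime_linear_form[OF nonzero] by (metis dvd_triv_left prime_elem_dvd_mult_iff)
  then obtain h where h: "det3 \<theta> V W = ?\<xi> * h" by (auto elim: dvdE)
  then have "?\<xi> * det3 U \<theta> W = ?\<xi> * (?\<eta> * h)" using eq by (simp add: mult_ac)
  then have h': "det3 U \<theta> W = ?\<eta> * h" using nonzero by simp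
  have \<theta>_eq: "\<theta> = (?\<xi> * h) *s U + (?\<eta> * h) *s V + det3 U V \<theta> *s W"
    using coords[of \<theta>] unfolding h h' .
  have euler_eq: "euler = ?\<xi> *s U + ?\<eta> *s V + det3 U V euler *s W"
    using coords[of euler] unfolding \<xi> \<eta> .
  have "(?\<xi> * h) *s U + (?\<eta> * h) *s V + t *s W
      = h *s (?\<xi> *s U + ?\<eta> *s V + e *s W) + (t - h * e) *s W" for t e
    by (simp add: vec_eq_iff algebra_simps)
  from this[of "det3 U V \<theta>" "det3 U V euler"]
  have "\<theta> = h *s euler + (det3 U V \<theta> - h * det3 U V euler) *s W"
    unfolding \<theta>_eq[symmetric] euler_eq[symmetric] .
  then show ?thesis unfolding W_def by (rule that)
qed

definition pencil_field :: "(complex^3) set set \<Rightarrow> complex^3 \<Rightarrow> S^3" where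
  "pencil_field A w = arr_poly {H \<in> A. w \<notin> H} *s const_field w"

lemma pencil_field_mem_derivation_module:
  "line_arrangement A \<Longrightarrow> pencil_field A w \<in> derivation_module A"
  by (simp add: pencil_field_def smult_const_field_mem_iff)

lemma homogeneous_pencil_field: "homogeneous_field (card {H \<in> A. w \<notin> H}) (pencil_field A w)"
  unfolding pencil_field_def by (intro homogeneous_field_smult_const_field homogeneous_arr_poly)

lemma radial_on_pencil_field:
  assumes A: "line_arrangement A" and L: "L \<in> A" "w \<notin> L"
  shows "radial_on L (pencil_field A w)"
proof -
  have "line_form L dvd arr_poly {H \<in> A. w \<notin> H}"
    using A L arr_poly_remove[of "{H \<in> A. w \<notin> H}" L] by (simp add: line_arrangementD)
  then show ?thesis
    using A L by (simp add: radial_on_def pencil_field_def line_form_dvd_iff line_arrangementD)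
qed

lemma card_le_degree_if_pencil_field_dependent:
  assumes A: "line_arrangement A" and x: "x \<in> derivation_module A"
    and hom: "homogeneous_field a x" "homogeneous_field b y" and w: "w \<noteq> 0"
    and dep: "det3 euler x (pencil_field A w) = 0" and det: "det3 euler x y \<noteq> 0"
  shows "card {H \<in> A. w \<notin> H} \<le> a"
proof -
  let ?Q = "arr_poly {H \<in> A. w \<notin> H}"
  have "?Q \<noteq> 0" using arr_poly_neq_0 line_arrangement_subset[OF A, of "{H \<in> A. w \<notin> H}"] by simp
  then have "det3 euler x (const_field w) = 0"
    using dep by (simp add: pencil_field_def det3_smult)
  then obtain g h where x_eq: "x = h *s euler + g *s const_field w"
    using euler_const_field_decomp[OF w] by metis
  then have "g *s const_field w = x - h *s euler" by simp
  also have "\<dots> \<in> derivation_module A"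
    using subspace_derivation_module x euler_mem_derivation_module[OF A]
    by (intro DerS.subspace_diff DerS.subspace_scale)
  finally obtain g' where g': "g = ?Q * g'"
    by (auto simp: smult_const_field_mem_iff[OF A] elim: dvdE)
  have factor: "det3 euler x y = det3 euler (pencil_field A w) y * g'"
    by (simp add: x_eq g' pencil_field_def det3_add det3_smult mult_ac)
  have "homogeneous (1 + card {H \<in> A. w \<notin> H} + b) (det3 euler (pencil_field A w) y)"
    by (intro homogeneous_det3 homogeneous_field_euler homogeneous_pencil_field hom)
  moreover have "homogeneous (1 + a + b) (det3 euler x y)"
    by (intro homogeneous_det3 homogeneous_field_euler hom)
  ultimately have "1 + card {H \<in> A. w \<notin> H} + b \<le> 1 + a + b"
    using homogeneous_factor(1) det unfolding factor by blast
  then show ?thesis by simp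
qed

lemma card_points_on_le_degree:
  assumes A: "line_arrangement A" and L: "L \<in> A"
    and x: "x \<in> derivation_module A" "homogeneous_field a x"
    and y: "y \<in> derivation_module A" "homogeneous_field b y"
    and deg: "1 + a + b = card A" "a \<le> b" and det: "det3 euler x y \<noteq> 0"
  shows "card (points_on A L) \<le> b + 1"
proof (rule ccontr)
  assume "\<not> card (points_on A L) \<le> b + 1"
  then have "radial_on L x" "radial_on L y"
    using deg(2) radial_on_if_many_points[OF A L x] radial_on_if_many_points[OF A L y] by simp_all
  then have "card A \<le> a + b"
    using card_le_degree_if_radial[OF A L x(1) y(1) x(2) y(2)] det by simp
  then show False using deg(1) by simp
qed

lemma card_lines_off_le_degree:
  assumes A: "line_arrangement A" and L: "L \<in> A" "w \<notin> L"
    and x: "x \<in> derivation_module A" "homogeneous_field a x" and y: "homogeneous_field b y"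
    and det: "det3 euler x y \<noteq> 0" and w: "w \<noteq> 0"
    and many: "a + 1 < card (points_on A L)" and deg: "a + card {H \<in> A. w \<notin> H} < card A"
  shows "card {H \<in> A. w \<notin> H} \<le> a"
proof -
  have radial: "radial_on L x" "radial_on L (pencil_field A w)"
    using radial_on_if_many_points[OF A L(1) x many] radial_on_pencil_field[OF A L] .
  have "det3 euler x (pencil_field A w) = 0"
  proof (rule ccontr)
    assume "det3 euler x (pencil_field A w) \<noteq> 0"
    then have "card A \<le> a + card {H \<in> A. w \<notin> H}"
      by (rule card_le_degree_if_radial[OF A L(1) x(1) pencil_field_mem_derivation_module[OF A]
            x(2) homogeneous_pencil_field radial])
    then show False using deg by simp
  qed
  then show ?thesis
    using card_le_degree_if_pencil_field_dependent[OF A x y w _ det] by simp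
qed

lemma free_imp_modular:
  assumes A: "line_arrangement A" "\<not> pencil A" and free: "free_arrangement A"
    and p: "p \<in> intersection_points A" and m: "card A \<le> 2 * point_mult A p"
  shows "modular_point A p"
proof (rule ccontr)
  assume "\<not> modular_point A p"
  then obtain L where L: "L \<in> A" "\<not> p \<subseteq> L" and many: "point_mult A p < card (points_on A L)"
    using non_modular_points_on[OF A(1) p] by metis
  obtain x y a b where x: "x \<in> derivation_module A" "homogeneous_field a x"
    and y: "y \<in> derivation_module A" "homogeneous_field b y"
    and ab: "1 + a + b = card A" "a \<le> b" and det: "det3 euler x y \<noteq> 0"
    using free_arrangement_euler_basis[OF A free] by metis
  have "point_mult A p \<le> b"
    using many card_points_on_le_degree[OF A(1) L(1) x y ab det] by simp
  then have a: "a + point_mult A p < card A" using ab(1) by simp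
  obtain w where w: "w \<noteq> 0" "p = vec.span {w}"
    using p by (auto simp: intersection_points_def proj_point_iff)
  have on: "p \<subseteq> H \<longleftrightarrow> w \<in> H" if "H \<in> A" for H
    using that A(1)
    by (simp add: w(2) span_singleton_subset_iff proj_line_subspace line_arrangementD)
  then have "{H \<in> A. \<not> p \<subseteq> H} = {H \<in> A. w \<notin> H}" by blast
  then have off: "card {H \<in> A. w \<notin> H} = card A - point_mult A p"
    using card_lines_off_point[OF line_arrangementD(1)[OF A(1)], of p] by simp
  have "w \<notin> L" using L on by blast
  then have "card A - point_mult A p \<le> a"
    using card_lines_off_le_degree[OF A(1) L(1) _ x y(2) det w(1)] a m many off by simp
  then show False using a by simp
qed

lemma modular_double_points_real_bounds:
  fixes A :: "(complex^3) set set"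
  assumes A: "line_arrangement A" "\<not> pencil A" and p: "modular_point A p"
    and large: "card A \<le> 2 * point_mult A p"
  defines "d \<equiv> real (card A)" and "m \<equiv> real (point_mult A p)"
  shows "- 2 * m\<^sup>2 + (3 * d - 1) * m - d\<^sup>2 + d \<le> real (card (double_points A))"
    and "d / 2 \<le> - 2 * m\<^sup>2 + (3 * d - 1) * m - d\<^sup>2 + d"
proof -
  have fin: "finite A" using A(1) by (rule line_arrangementD)
  have "proj_point p" using p by (auto simp: modular_point_def intersection_points_def)
  then obtain H where "H \<in> A" "\<not> p \<subseteq> H" using A(2) unfolding pencil_def by blast
  then have less: "point_mult A p < card A"
    unfolding point_mult_def by (intro psubset_card_mono[OF fin]) auto
  have factor: "- 2 * m\<^sup>2 + (3 * d - 1) * m - d\<^sup>2 + d = (d - m) * (2 * m + 1 - d)"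
    by (simp add: power2_eq_square algebra_simps)
  have "real ((card A - point_mult A p) * (2 * point_mult A p + 1 - card A))
      = (d - m) * (2 * m + 1 - d)"
    using less large by (simp add: d_def m_def of_nat_diff)
  then show "- 2 * m\<^sup>2 + (3 * d - 1) * m - d\<^sup>2 + d \<le> real (card (double_points A))"
    using modular_double_points_bound[OF A(1) p] unfolding factor by (metis of_nat_le_iff)
  have gaps: "1 \<le> d - m" "0 \<le> 2 * m - d" using less large by (simp_all add: d_def m_def)
  then have "d / 2 \<le> 1 * (2 * m - d) + (d - m)" by simp
  also have "\<dots> \<le> (d - m) * (2 * m - d) + (d - m)"
    using gaps by (intro add_right_mono mult_right_mono)
  also have "\<dots> = (d - m) * (2 * m + 1 - d)" by (simp add: algebra_simps)
  finally show "d / 2 \<le> - 2 * m\<^sup>2 + (3 * d - 1) * m - d\<^sup>2 + d" unfolding factor .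
qed

theorem theorem1p7:
  fixes A :: "(complex^3) set set" and d n2 :: nat
  assumes "line_arrangement A" and "\<not> pencil A"
    and "d = card A" and "n2 = card (double_points A)"
  shows "(\<forall>m. free_arrangement A \<and> m = max_mult A \<and> 2 * m \<ge> d \<longrightarrow>
            real n2 \<ge> - 2 * (real m)^2 + (3 * real d - 1) * real m - (real d)^2 + real d \<and>
            - 2 * (real m)^2 + (3 * real d - 1) * real m - (real d)^2 + real d \<ge> real d / 2)
       \<and> (\<forall>m. homogeneous_supersolvable m A \<and> 2 * m \<ge> d \<longrightarrow> real n2 \<ge> real d / 2)"
proof (intro conjI allI impI; elim conjE)
  fix m assume free: "free_arrangement A" and m: "m = max_mult A" "2 * m \<ge> d"
  obtain p where p: "p \<in> intersection_points A" "point_mult A p = m"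
    using max_mult_attained[OF assms(1,2)] m(1) by metis
  then have "modular_point A p"
    using free_imp_modular[OF assms(1,2) free] m(2) assms(3) by simp
  note bounds = modular_double_points_real_bounds[OF assms(1,2) this]
  show "real n2 \<ge> - 2 * (real m)^2 + (3 * real d - 1) * real m - (real d)^2 + real d"
    using bounds(1) p(2) m(2) assms(3,4) by simp
  show "- 2 * (real m)^2 + (3 * real d - 1) * real m - (real d)^2 + real d \<ge> real d / 2"
    using bounds(2) p(2) m(2) assms(3) by simp
next
  fix m assume "homogeneous_supersolvable m A" and "2 * m \<ge> d"
  then obtain p where "modular_point A p" "point_mult A p = m"
    by (auto simp: homogeneous_supersolvable_def supersolvable_def)
  then show "real n2 \<ge> real d / 2"
    using modular_double_points_real_bounds[OF assms(1,2)] \<open>2 * m \<ge> d\<close> assms(3,4) order_trans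
    by blast
qed

end
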